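(* Let $G$ be a topological group, let $(G,X)$ be a compact metric dynamical system and let $E=E(X)$ be its enveloping semigroup. We have the following alternative. Either (1) $E$ is a separable Rosenthal compact (hence $\operatorname{card} E\le 2^{\aleph_0}$); or (2) the compact space $E$ contains a homeomorphic copy of $\beta\mathbb{N}$, hence $\operatorname{card} E=2^{2^{\aleph_0}}$. The first possibility holds if and only if $E^f$ is a Rosenthal compact for every $f\in C(X)$.
   Context: A compact metric dynamical system $(G,X)$ is a compact metrizable space $X$ with a (jointly) continuous left action of the topological group $G$; $\breve g:X\to X$, $x\mapsto gx$. The enveloping semigroup $E(X)$ is the closure of $\{\breve g:g\in G\}$ in $X^X$ with the pointwise convergence topology. For $f\in C(X)$ (continuous real functions), $E^f=\{f\circ p:p\in E\}\subset\mathbb R^X$ with the pointwise topology. A topological space is a Rosenthal compact if it is homeomorphic to a pointwise compact subset of the space $B_1(Y)$ of real functions of the first Baire class on some Polish space $Y$. $\beta\mathbb N$ is the Stone-Čech compactification of the discrete space $\mathbb N$. *)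

theory Defs
  imports "HOL-Analysis.Analysis" "HOL-Algebra.Group_Action"
begin

section \<open>Topological groups and compact metric dynamical systems\<close>

text \<open>No separation axiom is imposed on the group.\<close>

locale topological_group = group G
  for G :: "('g, 'r) monoid_scheme" (structure) +
  fixes T :: "'g topology"
  assumes topspace_eq_carrier: "topspace T = carrier G"
    and continuous_mult: "continuous_map (prod_topology T T) T (\<lambda>(g, h). g \<otimes> h)"
    and continuous_inv: "continuous_map T T (\<lambda>g. inv g)"

text \<open>
  \<^locale>\<open>group_action\<close> makes each \<open>\<phi> g\<close> a bijection of \<^term>\<open>topspace X\<close> that is
  extensional (\<open>undefined\<close> outside), and composition in \<^const>\<open>BijGroup\<close> is
  \<open>(\<phi> g \<circ> \<phi> h)\<close>, so this is a left action and \<open>\<phi> g\<close> is literally a point of the power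
  \<^term>\<open>product_topology (\<lambda>_. X) (topspace X)\<close>.
\<close>

locale compact_metric_dynamical_system =
  topological_group G T + group_action G "topspace X" \<phi>
  for G :: "('g, 'r) monoid_scheme" (structure) and T :: "'g topology"
    and X :: "'x topology" and \<phi> :: "'g \<Rightarrow> 'x \<Rightarrow> 'x" +
  assumes compact: "compact_space X"
    and metrizable: "metrizable_space X"
    and continuous_action: "continuous_map (prod_topology T X) X (\<lambda>(g, x). \<phi> g x)"

definition enveloping_semigroup ::
    "('g, 'r) monoid_scheme \<Rightarrow> 'x topology \<Rightarrow> ('g \<Rightarrow> 'x \<Rightarrow> 'x) \<Rightarrow> ('x \<Rightarrow> 'x) set" where
  "enveloping_semigroup G X \<phi> =
     product_topology (\<lambda>_. X) (topspace X) closure_of (\<phi> ` carrier G)"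

definition enveloping_topology ::
    "('g, 'r) monoid_scheme \<Rightarrow> 'x topology \<Rightarrow> ('g \<Rightarrow> 'x \<Rightarrow> 'x) \<Rightarrow> ('x \<Rightarrow> 'x) topology" where
  "enveloping_topology G X \<phi> =
     subtopology (product_topology (\<lambda>_. X) (topspace X)) (enveloping_semigroup G X \<phi>)"

text \<open>
  The space \<open>E\<^sup>f\<close>: here \<^term>\<open>compose (topspace X) f p\<close> is \<open>f \<circ> p\<close> as a point
  of the power of the real line indexed by \<^term>\<open>topspace X\<close>.
\<close>

definition enveloping_orbit_topology ::
    "('g, 'r) monoid_scheme \<Rightarrow> 'x topology \<Rightarrow> ('g \<Rightarrow> 'x \<Rightarrow> 'x) \<Rightarrow> ('x \<Rightarrow> real) \<Rightarrow> ('x \<Rightarrow> real) topology"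
  where
  "enveloping_orbit_topology G X \<phi> f =
     subtopology (product_topology (\<lambda>_. euclideanreal) (topspace X))
       ((\<lambda>p. compose (topspace X) f p) ` enveloping_semigroup G X \<phi>)"

section \<open>Rosenthal compacta\<close>

definition polish_space_top :: "'a topology \<Rightarrow> bool" where
  "polish_space_top Y \<longleftrightarrow> completely_metrizable_space Y \<and> separable_space Y"

definition first_baire_class :: "'a topology \<Rightarrow> ('a \<Rightarrow> real) set" where
  "first_baire_class Y =
     {f \<in> extensional (topspace Y).
        \<exists>s :: nat \<Rightarrow> 'a \<Rightarrow> real. (\<forall>n. continuous_map Y euclideanreal (s n)) \<and>
          (\<forall>y \<in> topspace Y. (\<lambda>n. s n y) \<longlonglongrightarrow> f y)}"

definition rosenthal_compact_over :: "'b topology \<Rightarrow> 'a topology \<Rightarrow> bool" where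
  "rosenthal_compact_over Y Z \<longleftrightarrow>
     (\<exists>K \<subseteq> first_baire_class Y.
        compactin (product_topology (\<lambda>_. euclideanreal) (topspace Y)) K \<and>
        Z homeomorphic_space subtopology (product_topology (\<lambda>_. euclideanreal) (topspace Y)) K)"

text \<open>
  HOL cannot quantify over the type underlying the Polish space. This is no restriction: a
  Polish space has at most continuum many points, hence a homeomorphic copy whose points are
  real numbers (with some unrelated topology). See \<open>rosenthal_compactI\<close> below.
\<close>

definition rosenthal_compact :: "'a topology \<Rightarrow> bool" where
  "rosenthal_compact Z \<longleftrightarrow>
     (\<exists>Y :: real topology. polish_space_top Y \<and> rosenthal_compact_over Y Z)"

lemma polish_space_top_homeomorphic_real:
  fixes Y :: "'b topology"
  assumes "polish_space_top Y"
  obtains Y' :: "real topology" where "polish_space_top Y'" "Y homeomorphic_space Y'"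
proof -
  have met: "metrizable_space Y" and sep: "separable_space Y"
    using assms by (auto simp: polish_space_top_def completely_metrizable_imp_metrizable_space)
  obtain C where C: "countable C" "C \<subseteq> topspace Y" "Y closure_of C = topspace Y"
    using sep by (auto simp: separable_space_def)
  obtain M d where M: "Metric_space M d" "Y = Metric_space.mtopology M d"
    using met by (auto simp: metrizable_space_def)
  interpret Metric_space M d by fact
  have CM: "C \<subseteq> M" using C M by simp
  define F where "F x = {(c, q) \<in> C \<times> \<rat>. d c x < q}" for x
  have inj: "inj_on F M"
  proof (rule inj_onI, rule ccontr)
    fix x y assume xy: "x \<in> M" "y \<in> M" "F x = F y" "x \<noteq> y"
    have pos: "d x y / 2 > 0" using xy by simp
    have "x \<in> mtopology closure_of C" using C M xy by simp
    then have "\<exists>c\<in>C. c \<in> mball x (d x y / 2)"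
      using pos unfolding metric_closure_of by blast
    then obtain c where c: "c \<in> C" "d x c < d x y / 2"
      by (auto simp only: in_mball)
    then have cM: "c \<in> M" using CM by auto
    obtain q where q: "q \<in> \<rat>" "d x c < q" "q < d x y / 2"
      using Rats_dense_in_real[OF c(2)] by blast
    have "(c, q) \<in> F x" using q c by (simp add: F_def commute)
    then have "(c, q) \<in> F y" using xy(3) by simp
    then have "d c y < q" by (simp add: F_def)
    then have "d x y < d x y"
      using triangle[OF xy(1) cM xy(2)] q by linarith
    then show False by simp
  qed
  have "countable (C \<times> (\<rat> :: real set))" using C by (simp add: countable_rat)
  then obtain e :: "'b \<times> real \<Rightarrow> nat" where e: "inj_on e (C \<times> \<rat>)"
    by (auto simp: countable_def)
  have inj2: "inj_on (\<lambda>x. e ` F x) M"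
  proof (rule inj_onI)
    fix x y assume "x \<in> M" "y \<in> M" "e ` F x = e ` F y"
    moreover have "F x \<subseteq> C \<times> \<rat>" "F y \<subseteq> C \<times> \<rat>" by (auto simp: F_def)
    ultimately have "F x = F y" using e by (simp add: inj_on_image_eq_iff)
    then show "x = y" using inj \<open>x \<in> M\<close> \<open>y \<in> M\<close> by (simp add: inj_on_def)
  qed
  obtain r :: "nat set \<Rightarrow> real" where r: "inj r"
    using nat_sets_eqpoll_reals by (auto simp: eqpoll_def bij_betw_def)
  define h where "h x = r (e ` F x)" for x
  have h: "inj_on h (topspace Y)"
    using inj2 r M by (auto simp: h_def inj_on_def)
  define k where "k = inv_into (topspace Y) h"
  define Y' where "Y' = pullback_topology (h ` topspace Y) k Y"
  have tY': "topspace Y' = h ` topspace Y"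
    using h by (auto simp: Y'_def topspace_pullback_topology k_def)
  have "continuous_map Y' Y k"
    unfolding Y'_def by (metis continuous_map_id continuous_map_pullback comp_id id_comp)
  moreover have "continuous_map Y Y' h"
    unfolding Y'_def
  proof (rule continuous_map_pullback')
    show "continuous_map Y Y (k \<circ> h)"
      by (rule continuous_map_eq[OF continuous_map_id]) (simp add: k_def h)
  qed auto
  ultimately have "homeomorphic_maps Y Y' h k"
    using h tY' by (auto simp: homeomorphic_maps_def k_def)
  then have hom: "Y homeomorphic_space Y'" by (auto simp: homeomorphic_space_def)
  then have "polish_space_top Y'"
    using assms by (metis polish_space_top_def homeomorphic_completely_metrizable_space
        homeomorphic_separable_space)
  with hom show thesis by (rule that[rotated])
qed

lemma rosenthal_compact_over_homeomorphic:
  assumes "Y homeomorphic_space Y'" "rosenthal_compact_over Y Z"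
  shows "rosenthal_compact_over Y' Z"
proof -
  let ?P = "product_topology (\<lambda>_. euclideanreal) (topspace Y)"
  let ?P' = "product_topology (\<lambda>_. euclideanreal) (topspace Y')"
  obtain h k where hk: "homeomorphic_maps Y Y' h k"
    using assms by (auto simp: homeomorphic_space_def)
  have h: "continuous_map Y Y' h" and k: "continuous_map Y' Y k"
    and kh: "\<And>x. x \<in> topspace Y \<Longrightarrow> k (h x) = x" and hk': "\<And>y. y \<in> topspace Y' \<Longrightarrow> h (k y) = y"
    using hk by (auto simp: homeomorphic_maps_def)
  have hin: "\<And>x. x \<in> topspace Y \<Longrightarrow> h x \<in> topspace Y'"
    and kin: "\<And>y. y \<in> topspace Y' \<Longrightarrow> k y \<in> topspace Y"
    using h k by (auto simp: continuous_map_def)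
  define H :: "_ \<Rightarrow> _ \<Rightarrow> real" where "H f = (\<lambda>y \<in> topspace Y'. f (k y))" for f
  define J :: "_ \<Rightarrow> _ \<Rightarrow> real" where "J f = (\<lambda>x \<in> topspace Y. f (h x))" for f
  have "continuous_map ?P ?P' H"
    unfolding continuous_map_componentwise
    by (auto simp: H_def kin intro!: continuous_map_product_projection)
  moreover have "continuous_map ?P' ?P J"
    unfolding continuous_map_componentwise
    by (auto simp: J_def hin intro!: continuous_map_product_projection)
  ultimately have HJ: "homeomorphic_maps ?P ?P' H J"
    by (auto simp: homeomorphic_maps_def H_def J_def kh hk' hin kin PiE_def extensional_def fun_eq_iff)
  obtain K where K: "K \<subseteq> first_baire_class Y" "compactin ?P K"
    "Z homeomorphic_space subtopology ?P K"
    using assms by (auto simp: rosenthal_compact_over_def)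
  have "homeomorphic_map ?P ?P' H" using HJ homeomorphic_map_maps by blast
  moreover have "K \<subseteq> topspace ?P" using K compactin_subset_topspace by blast
  ultimately have "homeomorphic_map (subtopology ?P K) (subtopology ?P' (H ` K)) H"
    using homeomorphic_map_subtopologies[of ?P ?P' H K "H ` K"]
    by (metis homeomorphic_imp_surjective_map image_mono inf.absorb2)
  then have "Z homeomorphic_space subtopology ?P' (H ` K)"
    using K homeomorphic_map_imp_homeomorphic_space homeomorphic_space_trans by blast
  moreover have "compactin ?P' (H ` K)"
    using K \<open>continuous_map ?P ?P' H\<close> image_compactin by blast
  moreover have "H ` K \<subseteq> first_baire_class Y'"
  proof (intro image_subsetI)
    fix f assume "f \<in> K"
    then have "f \<in> first_baire_class Y" using K by blast
    then obtain s :: "nat \<Rightarrow> _ \<Rightarrow> real" where s: "\<And>n. continuous_map Y euclideanreal (s n)"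
      "\<And>y. y \<in> topspace Y \<Longrightarrow> (\<lambda>n. s n y) \<longlonglongrightarrow> f y"
      by (auto simp: first_baire_class_def)
    have "continuous_map Y' euclideanreal (s n \<circ> k)" for n
      using k s continuous_map_compose by blast
    then show "H f \<in> first_baire_class Y'"
      using s kin by (auto simp: first_baire_class_def H_def intro!: exI[of _ "\<lambda>n. s n \<circ> k"])
  qed
  ultimately show ?thesis unfolding rosenthal_compact_over_def by blast
qed

lemma rosenthal_compactI:
  fixes Y :: "'b topology"
  assumes "polish_space_top Y" "rosenthal_compact_over Y Z"
  shows "rosenthal_compact Z"
  using polish_space_top_homeomorphic_real[OF assms(1)] rosenthal_compact_over_homeomorphic assms(2)
  unfolding rosenthal_compact_def by metis

section \<open>Stone-Cech compactification\<close>

definition unit_interval_maps :: "'a topology \<Rightarrow> ('a \<Rightarrow> real) set" where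
  "unit_interval_maps X =
     {f \<in> extensional (topspace X). continuous_map X (top_of_set {0..1}) f}"

text \<open>
  The closure of the image of \<open>X\<close> under the evaluation map into the cube indexed by the
  continuous maps from \<open>X\<close> to the unit interval.
\<close>

definition stone_cech :: "'a topology \<Rightarrow> (('a \<Rightarrow> real) \<Rightarrow> real) topology" where
  "stone_cech X =
     (let Q = product_topology (\<lambda>_. top_of_set {0..1}) (unit_interval_maps X)
      in subtopology Q (Q closure_of ((\<lambda>x. \<lambda>f \<in> unit_interval_maps X. f x) ` topspace X)))"

abbreviation beta_nat :: "((nat \<Rightarrow> real) \<Rightarrow> real) topology" where
  "beta_nat \<equiv> stone_cech (discrete_topology (UNIV :: nat set))"

end

theory Submission
  imports Defs
begin

text \<open>
  The dichotomy is a dynamical form of the theorem of Bourgain, Fremlin and Talagrand, and it is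
  decided by tameness: whether each function \<open>f \<circ> p\<close>, with \<open>f\<close> continuous on \<open>X\<close> and \<open>p\<close> in the
  enveloping semigroup \<open>E\<close>, belongs to the first Baire class of \<open>X\<close>.
  
  If so, each space \<open>E\<^sup>f\<close> is a compact set of functions of the first class on \<open>X\<close>.  Countably many
  continuous functions separate the points of \<open>X\<close>, so \<open>E\<close> embeds into the first Baire class of the
  disjoint sum of countably many copies of \<open>X\<close> (\<open>tame_imp_E_rosenthal\<close>).  Moreover \<open>E\<close> is always
  separable, because the translations are continuous maps of a second countable space
  (\<open>countable_pointwise_dense_subset\<close>).
  
  If not, some \<open>h = f \<circ> p\<close> violates Baire's criterion (\<open>first_baire_class_criterion\<close>): there are a
  nonempty closed set and numbers \<open>a < b\<close> such that the points with \<open>h \<le> a\<close> and those with \<open>h \<ge> b\<close>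
  are both dense in it.  As \<open>h\<close> is a pointwise limit of functions \<open>f \<circ> \<phi> g\<close>, a splitting construction
  (\<open>oscillation_imp_independent_sequence\<close>) and compactness produce a sequence of translations
  such that for every set \<open>A\<close> of indices some point of \<open>X\<close> makes \<open>f \<circ> \<phi> (g k)\<close> small for \<open>k\<close> in \<open>A\<close>
  and large for all other \<open>k\<close>.  Complementary subsequences then have disjoint closures, both in \<open>E\<close>
  and in \<open>E\<^sup>f\<close>, and a sequence of this kind in a compact Hausdorff space spans a copy of the
  Stone-Cech compactification of the integers (\<open>complement_separated_imp_beta_nat_embeds\<close>).
  
  Cardinality does the rest.  The first Baire class of a Polish space has at most continuum many
  elements, whereas an independent family of sets gives \<open>beta_nat\<close> as many points as there are sets
  of sets of integers (\<open>lepoll_beta_nat\<close>), which is also an upper bound for \<open>E\<close>.  So no Rosenthal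
  compact contains \<open>beta_nat\<close>.  Hence the alternatives exclude each other, and if tameness fails then
  neither \<open>E\<close> nor every \<open>E\<^sup>f\<close> is a Rosenthal compact, which is the final equivalence.
\<close>

section \<open>Functions of the first Baire class\<close>

text \<open>
  Following classical terminology, these are the sets of ambiguous class two.  They form a
  Boolean algebra, and a set belongs to it exactly when its indicator function is a pointwise
  limit of continuous functions (on a metrizable space).
\<close>

definition ambiguous_in :: "'a topology \<Rightarrow> 'a set \<Rightarrow> bool" where
  "ambiguous_in X D \<longleftrightarrow> fsigma_in X D \<and> gdelta_in X D"

lemma ambiguous_in_subset: "ambiguous_in X D \<Longrightarrow> D \<subseteq> topspace X"
  by (simp add: ambiguous_in_def fsigma_in_subset)

lemma ambiguous_in_empty [iff]: "ambiguous_in X {}"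
  by (simp add: ambiguous_in_def)

lemma ambiguous_in_Un: "ambiguous_in X D \<Longrightarrow> ambiguous_in X E \<Longrightarrow> ambiguous_in X (D \<union> E)"
  by (simp add: ambiguous_in_def fsigma_in_Un gdelta_in_Un)

lemma ambiguous_in_Int: "ambiguous_in X D \<Longrightarrow> ambiguous_in X E \<Longrightarrow> ambiguous_in X (D \<inter> E)"
  by (simp add: ambiguous_in_def fsigma_in_Int gdelta_in_Int)

lemma ambiguous_in_Diff: "ambiguous_in X D \<Longrightarrow> ambiguous_in X E \<Longrightarrow> ambiguous_in X (D - E)"
  by (simp add: ambiguous_in_def fsigma_in_diff gdelta_in_diff)

lemma openin_imp_ambiguous_in: "metrizable_space X \<Longrightarrow> openin X U \<Longrightarrow> ambiguous_in X U"
  by (simp add: ambiguous_in_def open_imp_gdelta_in open_imp_fsigma_in)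

lemma closedin_imp_ambiguous_in: "metrizable_space X \<Longrightarrow> closedin X U \<Longrightarrow> ambiguous_in X U"
  by (simp add: ambiguous_in_def closed_imp_fsigma_in closed_imp_gdelta_in)

text \<open>
  Cutting each piece off at the earlier open sets makes the pieces disjoint, so the complement of
  the union is glued together in the same way from the pieces \<open>U n - D n\<close>, apart from the closed
  set outside all \<open>U n\<close>.  Both the union and its complement are therefore \<open>F\<^sub>\<sigma>\<close> sets.
\<close>

lemma ambiguous_in_glue:
  fixes U D :: "nat \<Rightarrow> 'a set"
  assumes X: "metrizable_space X" and U: "\<And>n. openin X (U n)"
    and D: "\<And>n. ambiguous_in X (D n)" and DU: "\<And>n. D n \<subseteq> U n"
  shows "ambiguous_in X (\<Union>n. D n - (\<Union>m<n. U m))"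
proof -
  have op: "ambiguous_in X (\<Union>m<n. U m)" for n
    using U by (intro openin_imp_ambiguous_in X) auto
  have fs: "fsigma_in X (\<Union>n. E n)" if "\<And>n. ambiguous_in X (E n)" for E :: "nat \<Rightarrow> 'a set"
    using that by (intro fsigma_in_Union) (auto simp: ambiguous_in_def)
  let ?D = "\<Union>n. D n - (\<Union>m<n. U m)"
  have sub: "?D \<subseteq> topspace X"
    using ambiguous_in_subset[OF D] by blast
  have 1: "fsigma_in X ?D"
    by (intro fs ambiguous_in_Diff D op)
  have eq: "topspace X - ?D = (topspace X - (\<Union>n. U n)) \<union> (\<Union>n. (U n - D n) - (\<Union>m<n. U m))" (is "?L = ?R")
  proof (intro Set.set_eqI iffI)
    fix x assume x: "x \<in> ?L"
    show "x \<in> ?R"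
    proof (cases "\<exists>n. x \<in> U n")
      case True
      define n where "n = (LEAST n. x \<in> U n)"
      have "x \<in> U n" unfolding n_def using True by (rule LeastI_ex)
      moreover have "x \<notin> U m" if "m < n" for m
        using that not_less_Least unfolding n_def by blast
      ultimately show ?thesis using x by auto
    qed (use x in auto)
  next
    fix x assume x: "x \<in> ?R"
    show "x \<in> ?L"
    proof (cases "x \<in> topspace X - (\<Union>n. U n)")
      case True
      then show ?thesis using DU by blast
    next
      case False
      then obtain n where n: "x \<in> U n" "x \<notin> D n" "\<And>m. m < n \<Longrightarrow> x \<notin> U m" using x by auto
      have "x \<notin> D k - (\<Union>m<k. U m)" for k
        using n DU[of k] by (cases k n rule: linorder_cases) auto
      then show ?thesis using n(1) openin_subset[OF U] by blast
    qed
  qed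
  have "fsigma_in X (topspace X - ?D)"
    unfolding eq
  proof (rule fsigma_in_Un)
    show "fsigma_in X (topspace X - (\<Union>n. U n))"
      using U by (intro closed_imp_fsigma_in) auto
    show "fsigma_in X (\<Union>n. (U n - D n) - (\<Union>m<n. U m))"
      by (intro fs ambiguous_in_Diff D op) (use X U openin_imp_ambiguous_in in blast)
  qed
  then show ?thesis
    using 1 sub by (simp add: ambiguous_in_def gdelta_in_fsigma_in)
qed

text \<open>
  A Cantor-Bendixson type argument with the transfinite iteration replaced by a maximal open set:
  by gluing along a countable base there is a largest open set \<open>W\<close> inside which \<open>A\<close> and \<open>B\<close> can be
  separated.  If its complement \<open>P\<close> were nonempty, one of \<open>A\<close> and \<open>B\<close> would miss a nonempty
  relatively open piece of \<open>P\<close>, on which separation is trivial, and \<open>W\<close> could be enlarged.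
\<close>

lemma ambiguous_separation:
  assumes X: "metrizable_space X" and sc: "second_countable X" and B: "B \<subseteq> topspace X"
    and nd: "\<And>P. closedin X P \<Longrightarrow> P \<noteq> {} \<Longrightarrow>
               \<not> (P \<subseteq> X closure_of (P \<inter> A) \<and> P \<subseteq> X closure_of (P \<inter> B))"
  obtains D where "ambiguous_in X D" "B \<subseteq> D" "D \<inter> A = {}"
proof -
  define good where "good U \<longleftrightarrow> openin X U \<and> (\<exists>D. ambiguous_in X D \<and> U \<inter> B \<subseteq> D \<and> D \<subseteq> U - A)" for U
  obtain \<B> where \<B>: "countable \<B>" "\<And>V. V \<in> \<B> \<Longrightarrow> openin X V"
    "\<And>U x. openin X U \<Longrightarrow> x \<in> U \<Longrightarrow> \<exists>V\<in>\<B>. x \<in> V \<and> V \<subseteq> U"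
    using sc unfolding second_countable_def by metis
  have good_mono: "good V" if U: "good U" and V: "openin X V" "V \<subseteq> U" for U V
  proof -
    obtain D where D: "ambiguous_in X D" "U \<inter> B \<subseteq> D" "D \<subseteq> U - A"
      using U unfolding good_def by blast
    have "ambiguous_in X (V \<inter> D)"
      by (intro ambiguous_in_Int openin_imp_ambiguous_in X D V)
    moreover have "V \<inter> B \<subseteq> V \<inter> D" "V \<inter> D \<subseteq> V - A" using D V by auto
    ultimately show ?thesis using V(1) unfolding good_def by blast
  qed
  have "good {}" by (auto simp: good_def)
  define \<G> where "\<G> = insert {} {V\<in>\<B>. good V}"
  have "countable \<G>" using \<B>(1) by (simp add: \<G>_def)
  then obtain U :: "nat \<Rightarrow> 'a set" where U: "range U = \<G>"
    using uncountable_def[of \<G>] by (auto simp: \<G>_def)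
  have gU: "good (U n)" for n
  proof -
    have "U n \<in> \<G>" using U by blast
    then show ?thesis using \<open>good {}\<close> by (auto simp: \<G>_def)
  qed
  then obtain D where D: "\<And>n. ambiguous_in X (D n)" "\<And>n. U n \<inter> B \<subseteq> D n" "\<And>n. D n \<subseteq> U n - A"
    unfolding good_def by metis
  define W where "W = (\<Union>n. U n)"
  define DW where "DW = (\<Union>n. D n - (\<Union>m<n. U m))"
  have opU: "openin X (U n)" for n using gU by (simp add: good_def)
  have opW: "openin X W" using opU by (auto simp: W_def)
  have DW: "ambiguous_in X DW"
    unfolding DW_def by (rule ambiguous_in_glue) (use X opU D in blast)+
  have WB: "W \<inter> B \<subseteq> DW"
  proof
    fix x assume x: "x \<in> W \<inter> B"
    define n where "n = (LEAST n. x \<in> U n)"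
    have "\<exists>n. x \<in> U n" using x by (auto simp: W_def)
    then have "x \<in> U n" unfolding n_def by (rule LeastI_ex)
    then have "x \<in> D n" using x D(2)[of n] by blast
    moreover have "x \<notin> U m" if "m < n" for m
      using that not_less_Least unfolding n_def by blast
    ultimately have "x \<in> D n - (\<Union>m<n. U m)" by blast
    then show "x \<in> DW" unfolding DW_def by (rule UN_I[OF UNIV_I])
  qed
  have DWA: "DW \<subseteq> W - A" using D(3) unfolding DW_def W_def by (auto simp: subset_iff)
  have max: "V \<subseteq> W" if gV: "good V" for V
  proof
    fix x assume "x \<in> V"
    then obtain V' where V': "V' \<in> \<B>" "x \<in> V'" "V' \<subseteq> V"
      using \<B>(3)[of V x] gV by (auto simp: good_def)
    then have "V' \<in> \<G>" using good_mono[OF gV] \<B> by (auto simp: \<G>_def)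
    then show "x \<in> W" using V' U unfolding W_def by blast
  qed
  have "W = topspace X"
  proof (rule ccontr)
    assume "W \<noteq> topspace X"
    define P where "P = topspace X - W"
    have P: "closedin X P" "P \<noteq> {}"
      using opW \<open>W \<noteq> topspace X\<close> openin_subset[OF opW] by (auto simp: P_def)
    \<comment> \<open>The set \<open>C\<close> that fails to be dense in \<open>P\<close> is avoided by \<open>V \<inter> P\<close>; all of \<open>V \<inter> P\<close> goes
      to the side of the other set.\<close>
    have "\<exists>C. (C = A \<or> C = B) \<and> \<not> P \<subseteq> X closure_of (P \<inter> C)"
      using nd[OF P] by blast
    then obtain C x where C: "C = A \<or> C = B" and x: "x \<in> P" "x \<notin> X closure_of (P \<inter> C)" by blast
    then have "x \<in> topspace X" by (simp add: P_def)
    with x obtain V where V: "x \<in> V" "openin X V" "\<not> (\<exists>y. y \<in> P \<inter> C \<and> y \<in> V)"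
      by (auto simp: in_closure_of)
    have VP: "ambiguous_in X (V \<inter> P)"
      by (intro ambiguous_in_Int openin_imp_ambiguous_in closedin_imp_ambiguous_in X V P)
    define D' where "D' = (if C = A then DW \<union> (V \<inter> P) else DW)"
    have "ambiguous_in X D'" using VP DW by (auto simp: D'_def intro: ambiguous_in_Un)
    moreover have "(W \<union> V) \<inter> B \<subseteq> D'"
      using WB V C openin_subset[OF V(2)] unfolding D'_def P_def by (auto split: if_splits)
    moreover have "D' \<subseteq> (W \<union> V) - A"
      using DWA V by (auto simp: D'_def)
    ultimately have "good (W \<union> V)" using opW V by (auto simp: good_def)
    then have "x \<in> W" using max V by blast
    then show False using x by (simp add: P_def)
  qed
  then show thesis using that[of DW] DW WB DWA B by blast
qed

text \<open>
  Exhaust \<open>D\<close> and its complement by increasing sequences of closed sets and take Urysohn functions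
  for the \<open>n\<close>-th pair: at every point they are eventually constant.
\<close>

lemma ambiguous_in_indicator_limit:
  assumes X: "normal_space X" and D: "ambiguous_in X D"
  obtains u :: "nat \<Rightarrow> 'a \<Rightarrow> real" where "\<And>n. continuous_map X euclideanreal (u n)"
    "\<And>n x. x \<in> topspace X \<Longrightarrow> 0 \<le> u n x \<and> u n x \<le> 1"
    "\<And>x. x \<in> topspace X \<Longrightarrow> (\<lambda>n. u n x) \<longlonglongrightarrow> indicator D x"
proof -
  obtain F where F: "\<And>n. closedin X (F n)" "\<And>n. F n \<subseteq> F (Suc n)" "\<Union>(range F) = D"
    using D by (auto simp: ambiguous_in_def fsigma_in_ascending)
  obtain H where H: "\<And>n. closedin X (H n)" "\<And>n. H n \<subseteq> H (Suc n)" "\<Union>(range H) = topspace X - D"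
    using D by (auto simp: ambiguous_in_def gdelta_in_fsigma_in fsigma_in_ascending)
  have "\<exists>f. continuous_map X (top_of_set {0..1::real}) f \<and> f ` H n \<subseteq> {0} \<and> f ` F n \<subseteq> {1}" for n
  proof -
    have "disjnt (H n) (F n)" using F(3) H(3) unfolding disjnt_def by blast
    then show ?thesis using Urysohn_lemma[OF X H(1) F(1), of n n 0 1] by (metis zero_le_one)
  qed
  then obtain u where u: "\<And>n. continuous_map X (top_of_set {0..1::real}) (u n)"
     "\<And>n. u n ` H n \<subseteq> {0}" "\<And>n. u n ` F n \<subseteq> {1}" by metis
  have mF: "F m \<subseteq> F n" and mH: "H m \<subseteq> H n" if "m \<le> n" for m n
    using that F(2) H(2) lift_Suc_mono_le by blast+
  have "(\<lambda>n. u n x) \<longlonglongrightarrow> indicator D x" if x: "x \<in> topspace X" for x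
  proof (cases "x \<in> D")
    case True
    then obtain m where "x \<in> F m" using F by blast
    then have "u n x = indicator D x" if "n \<ge> m" for n using mF[OF that] u(3)[of n] True by (auto simp: image_subset_iff)
    then have "eventually (\<lambda>n. u n x = indicator D x) sequentially" unfolding eventually_sequentially by blast
    then show ?thesis by (rule tendsto_eventually)
  next
    case False
    then obtain m where "x \<in> H m" using H x by blast
    then have "u n x = indicator D x" if "n \<ge> m" for n using mH[OF that] u(2)[of n] False by (auto simp: image_subset_iff)
    then have "eventually (\<lambda>n. u n x = indicator D x) sequentially" unfolding eventually_sequentially by blast
    then show ?thesis by (rule tendsto_eventually)
  qed
  moreover have "continuous_map X euclideanreal (u n)" "x \<in> topspace X \<Longrightarrow> 0 \<le> u n x \<and> u n x \<le> 1" for n x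
    using u(1)[of n] by (auto simp: continuous_map_in_subtopology image_subset_iff Pi_iff)
  ultimately show thesis using that by blast
qed

text \<open>
  The form in which the Baire class one property enters: the levels of \<open>r\<close> above \<open>b\<close> and below \<open>a\<close>
  are separated by ambiguous sets.
\<close>

definition level_separable :: "'a topology \<Rightarrow> ('a \<Rightarrow> real) \<Rightarrow> bool" where
  "level_separable X r \<longleftrightarrow> (\<forall>a b. a < b \<longrightarrow>
     (\<exists>D. ambiguous_in X D \<and> {x \<in> topspace X. b \<le> r x} \<subseteq> D \<and> D \<inter> {x. r x \<le> a} = {}))"

lemma level_separable_diff_indicator:
  assumes r: "level_separable X r" and E: "ambiguous_in X E"
  shows "level_separable X (\<lambda>x. r x - c * indicator E x)"
  unfolding level_separable_def
proof (intro allI impI)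
  fix a b :: real assume ab: "a < b"
  obtain D1 where D1: "ambiguous_in X D1" "{x \<in> topspace X. b \<le> r x} \<subseteq> D1" "D1 \<inter> {x. r x \<le> a} = {}"
    using r ab unfolding level_separable_def by blast
  obtain D2 where D2: "ambiguous_in X D2" "{x \<in> topspace X. b + c \<le> r x} \<subseteq> D2" "D2 \<inter> {x. r x \<le> a + c} = {}"
    using r ab unfolding level_separable_def by (meson add_strict_right_mono)
  have "ambiguous_in X ((D1 - E) \<union> (D2 \<inter> E))"
    by (intro ambiguous_in_Un ambiguous_in_Diff ambiguous_in_Int D1 D2 E)
  moreover have "{x \<in> topspace X. b \<le> r x - c * indicator E x} \<subseteq> (D1 - E) \<union> (D2 \<inter> E)"
    using D1(2) D2(2) by (auto simp: indicator_def)
  moreover have "((D1 - E) \<union> (D2 \<inter> E)) \<inter> {x. r x - c * indicator E x \<le> a} = {}"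
    using D1(3) D2(3) by (auto simp: indicator_def split: if_splits)
  ultimately show "\<exists>D. ambiguous_in X D \<and> {x \<in> topspace X. b \<le> r x - c * indicator E x} \<subseteq> D \<and>
     D \<inter> {x. r x - c * indicator E x \<le> a} = {}" by blast
qed

text \<open>
  A greedy expansion with ratio two thirds.  If the remainder takes values in \<open>[0, 3 w]\<close>, subtract
  \<open>w\<close> on a set separating the points with remainder at least \<open>2 w\<close> from those with remainder at
  most \<open>w\<close>; the new remainder takes values in \<open>[0, 2 w]\<close>.
\<close>

lemma level_separable_expansion:
  assumes h: "level_separable X h" and M: "\<And>x. x \<in> topspace X \<Longrightarrow> 0 \<le> h x \<and> h x \<le> M"
  obtains D where "\<And>j::nat. ambiguous_in X (D j)"
    "\<And>x. x \<in> topspace X \<Longrightarrow> (\<lambda>j. M / 3 * (2/3)^j * indicator (D j) x) sums h x"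
proof -
  let ?P = "\<lambda>j r. level_separable X r \<and> (\<forall>x\<in>topspace X. 0 \<le> r x \<and> r x \<le> M * (2/3)^j)"
  let ?Q = "\<lambda>j r r'. \<exists>D. ambiguous_in X D \<and> r' = (\<lambda>x. r x - M / 3 * (2/3)^j * indicator D x)"
  have step: "\<exists>r'. ?P (Suc j) r' \<and> ?Q j r r'" if r: "?P j r" for j r
  proof (cases "M > 0")
    case True
    define w where "w = M / 3 * (2/3)^j"
    have "w > 0" using True by (simp add: w_def)
    then obtain D where D: "ambiguous_in X D" "{x \<in> topspace X. 2 * w \<le> r x} \<subseteq> D" "D \<inter> {x. r x \<le> w} = {}"
      using r[THEN conjunct1, unfolded level_separable_def, rule_format, of w "2 * w"] by auto
    have "0 \<le> r x - w * indicator D x \<and> r x - w * indicator D x \<le> M * (2/3)^Suc j" if x: "x \<in> topspace X" for x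
    proof -
      have "0 \<le> r x" "r x \<le> 3 * w" using r x by (auto simp: w_def)
      moreover have "M * (2/3)^Suc j = 2 * w" by (simp add: w_def)
      moreover have "x \<in> D \<Longrightarrow> w < r x" "x \<notin> D \<Longrightarrow> r x < 2 * w" using D x by force+
      ultimately show ?thesis by (cases "x \<in> D") auto
    qed
    moreover have "level_separable X (\<lambda>x. r x - w * indicator D x)"
      using r D by (intro level_separable_diff_indicator) auto
    ultimately show ?thesis using D(1) unfolding w_def by blast
  next
    case False
    \<comment> \<open>Here \<open>M = 0\<close> unless the space is empty, and the remainder vanishes already.\<close>
    have "r x = 0 \<and> (x \<in> topspace X \<longrightarrow> M = 0)" if x: "x \<in> topspace X" for x
    proof -
      have "M = 0" using M[OF x] False by linarith
      then show ?thesis using r x by force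
    qed
    then have "?P (Suc j) r" using r by auto
    moreover have "?Q j r r" by (intro exI[of _ "{}"]) auto
    ultimately show ?thesis by blast
  qed
  have "\<exists>R. \<forall>j. (?P j (R j) \<and> (j = 0 \<longrightarrow> R j = h)) \<and> ?Q j (R j) (R (Suc j))"
  proof (rule dependent_nat_choice)
    show "\<exists>r. ?P 0 r \<and> (0 = (0::nat) \<longrightarrow> r = h)" using h M by auto
  next
    fix r j assume "?P j r \<and> (j = 0 \<longrightarrow> r = h)"
    then obtain r' where "?P (Suc j) r'" "?Q j r r'" using step[of r j] by blast
    then show "\<exists>r'. (?P (Suc j) r' \<and> (Suc j = 0 \<longrightarrow> r' = h)) \<and> ?Q j r r'" by blast
  qed
  then obtain R where R: "\<And>j. ?P j (R j)" "R 0 = h" and Q: "\<And>j. ?Q j (R j) (R (Suc j))"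
    by blast
  have "\<exists>D. \<forall>j. ambiguous_in X (D j) \<and> R (Suc j) = (\<lambda>x. R j x - M / 3 * (2/3)^j * indicator (D j) x)"
    by (rule choice) (rule allI, rule Q)
  then obtain D where D: "\<And>j. ambiguous_in X (D j)"
    "\<And>j. R (Suc j) = (\<lambda>x. R j x - M / 3 * (2/3)^j * indicator (D j) x)"
    by auto
  have "(\<lambda>j. M / 3 * (2/3)^j * indicator (D j) x) sums h x" if x: "x \<in> topspace X" for x
  proof -
    have part: "(\<Sum>j<n. M / 3 * (2/3)^j * indicator (D j) x) = h x - R n x" for n
      by (induction n) (simp_all add: R D)
    have "(\<lambda>n. M * (2/3)^n) \<longlonglongrightarrow> M * 0"
      by (intro tendsto_mult tendsto_const LIMSEQ_power_zero) simp
    then have "(\<lambda>n. M * (2/3)^n) \<longlonglongrightarrow> 0" by simp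
    then have "(\<lambda>n. R n x) \<longlonglongrightarrow> 0"
      by (rule tendsto_sandwich[OF _ _ tendsto_const, rotated 2]) (use R x in auto)
    then have "(\<lambda>n. h x - R n x) \<longlonglongrightarrow> h x - 0" by (intro tendsto_diff tendsto_const)
    then show ?thesis unfolding sums_def part by simp
  qed
  with D show thesis using that by blast
qed

text \<open>
  Approximate each indicator function of the expansion by continuous functions.  The geometric
  weights dominate the terms, so by Tannery's theorem the diagonal partial sums converge.
\<close>

lemma level_separable_imp_pointwise_limit:
  assumes X: "normal_space X" and h: "level_separable X h" and M: "\<And>x. x \<in> topspace X \<Longrightarrow> 0 \<le> h x \<and> h x \<le> M"
  obtains s :: "nat \<Rightarrow> 'a \<Rightarrow> real" where "\<And>n. continuous_map X euclideanreal (s n)"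
    "\<And>x. x \<in> topspace X \<Longrightarrow> (\<lambda>n. s n x) \<longlonglongrightarrow> h x"
proof -
  obtain D where D: "\<And>j::nat. ambiguous_in X (D j)"
    "\<And>x. x \<in> topspace X \<Longrightarrow> (\<lambda>j. M / 3 * (2/3)^j * indicator (D j) x) sums h x"
    using level_separable_expansion[OF h M] by blast
  have "\<exists>u::nat \<Rightarrow> 'a \<Rightarrow> real. (\<forall>n. continuous_map X euclideanreal (u n)) \<and>
    (\<forall>n x. x \<in> topspace X \<longrightarrow> 0 \<le> u n x \<and> u n x \<le> 1) \<and>
    (\<forall>x. x \<in> topspace X \<longrightarrow> (\<lambda>n. u n x) \<longlonglongrightarrow> indicator (D j) x)" for j
    by (rule ambiguous_in_indicator_limit[OF X D(1)[of j]]) blast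
  then obtain u :: "nat \<Rightarrow> nat \<Rightarrow> 'a \<Rightarrow> real" where u: "\<And>j n. continuous_map X euclideanreal (u j n)"
    "\<And>j n x. x \<in> topspace X \<Longrightarrow> 0 \<le> u j n x \<and> u j n x \<le> 1"
    "\<And>j x. x \<in> topspace X \<Longrightarrow> (\<lambda>n. u j n x) \<longlonglongrightarrow> indicator (D j) x"
    by metis
  define s where "s n x = (\<Sum>j<n. M / 3 * (2/3)^j * u j n x)" for n x
  have "continuous_map X euclideanreal (s n)" for n
    unfolding s_def by (intro continuous_intros u) auto
  moreover have "(\<lambda>n. s n x) \<longlonglongrightarrow> h x" if x: "x \<in> topspace X" for x
  proof -
    define a where "a j n = (if j < n then M / 3 * (2/3)^j * u j n x else 0)" for j n
    have Mpos: "M \<ge> 0" using M[OF x] by linarith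
    have lim: "(\<lambda>n. a j n) \<longlonglongrightarrow> M / 3 * (2/3)^j * indicator (D j) x" for j
    proof (rule Lim_transform_eventually)
      show "(\<lambda>n. M / 3 * (2/3)^j * u j n x) \<longlonglongrightarrow> M / 3 * (2/3)^j * indicator (D j) x"
        by (intro tendsto_mult tendsto_const u x)
      show "\<forall>\<^sub>F n in sequentially. M / 3 * (2/3)^j * u j n x = a j n"
        using eventually_gt_at_top[of j] by eventually_elim (simp add: a_def)
    qed
    have bnd: "norm (a j n) \<le> M / 3 * (2/3)^j" for j n
    proof -
      have "\<bar>u j n x\<bar> \<le> 1" using u(2)[OF x, of j n] by linarith
      then have "M / 3 * (2/3)^j * \<bar>u j n x\<bar> \<le> M / 3 * (2/3)^j * 1"
        using Mpos by (intro mult_left_mono) auto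
      then show ?thesis using Mpos by (simp add: a_def abs_mult)
    qed
    have "(\<lambda>n. suminf (\<lambda>j. a j n)) \<longlonglongrightarrow> (\<Sum>j. M / 3 * (2/3)^j * indicator (D j) x)"
    proof (rule tannerys_theorem[OF lim, THEN conjunct2, THEN conjunct2])
      show "\<forall>\<^sub>F (j, n) in at_top \<times>\<^sub>F sequentially. norm (a j n) \<le> M / 3 * (2 / 3) ^ j"
        by (rule always_eventually) (clarify, rule bnd)
      show "summable (\<lambda>j. M / 3 * (2 / 3) ^ j)" by (intro summable_mult summable_geometric) simp
    qed simp
    moreover have "suminf (\<lambda>j. a j n) = s n x" for n
    proof -
      have "suminf (\<lambda>j. a j n) = (\<Sum>j<n. a j n)" by (rule suminf_finite) (auto simp: a_def)
      then show ?thesis by (simp add: a_def s_def)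
    qed
    ultimately show ?thesis using D(2)[OF x] by (simp add: sums_iff)
  qed
  ultimately show thesis using that by blast
qed

text \<open>
  The sufficient half of Baire's characterization: a bounded function outside the first class oscillates
  by a fixed amount everywhere on some nonempty closed set.
\<close>

theorem first_baire_class_criterion:
  assumes X: "metrizable_space X" and sc: "second_countable X"
    and h: "h \<in> extensional (topspace X)" and M: "\<And>x. x \<in> topspace X \<Longrightarrow> \<bar>h x\<bar> \<le> M"
    and nd: "\<And>P a b. closedin X P \<Longrightarrow> P \<noteq> {} \<Longrightarrow> a < b \<Longrightarrow>
               \<not> (P \<subseteq> X closure_of {x \<in> P. h x \<le> a} \<and> P \<subseteq> X closure_of {x \<in> P. b \<le> h x})"
  shows "h \<in> first_baire_class X"
proof -
  have "level_separable X (\<lambda>x. h x + M)"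
    unfolding level_separable_def
  proof (intro allI impI)
    fix a b :: real assume ab: "a < b"
    have sep: "\<not> (P \<subseteq> X closure_of (P \<inter> {x. h x + M \<le> a}) \<and> P \<subseteq> X closure_of (P \<inter> {x \<in> topspace X. b \<le> h x + M}))"
      if P: "closedin X P" "P \<noteq> {}" for P
    proof -
      have "P \<inter> {x. h x + M \<le> a} = {x \<in> P. h x \<le> a - M}"
        "P \<inter> {x \<in> topspace X. b \<le> h x + M} = {x \<in> P. b - M \<le> h x}"
        using closedin_subset[OF P(1)] by auto
      then show ?thesis using nd[OF P, of "a - M" "b - M"] ab by simp
    qed
    show "\<exists>D. ambiguous_in X D \<and> {x \<in> topspace X. b \<le> h x + M} \<subseteq> D \<and> D \<inter> {x. h x + M \<le> a} = {}"
      by (rule ambiguous_separation[OF X sc _ sep]) blast+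
  qed
  moreover have "0 \<le> h x + M \<and> h x + M \<le> 2 * M" if "x \<in> topspace X" for x using M[OF that] by auto
  ultimately obtain s :: "nat \<Rightarrow> 'a \<Rightarrow> real" where s: "\<And>n. continuous_map X euclideanreal (s n)"
    "\<And>x. x \<in> topspace X \<Longrightarrow> (\<lambda>n. s n x) \<longlonglongrightarrow> h x + M"
    using level_separable_imp_pointwise_limit[OF metrizable_imp_normal_space[OF X]] by blast
  have "continuous_map X euclideanreal (\<lambda>x. s n x - M)" for n by (intro continuous_intros s)
  moreover have "(\<lambda>n. s n x - M) \<longlonglongrightarrow> h x" if "x \<in> topspace X" for x
    using tendsto_diff[OF s(2)[OF that] tendsto_const[of M]] by simp
  ultimately show ?thesis
    using h unfolding first_baire_class_def by (auto intro!: exI[of _ "\<lambda>n x. s n x - M"])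
qed

section \<open>Independent sequences\<close>

text \<open>
  Suppose that \<open>h\<close> is at most \<open>a\<close> on a dense set and at least \<open>b\<close> on a dense set of points of \<open>P\<close> and is a pointwise
  limit point of the functions \<open>F i\<close>.  Choose the sequence inductively, so that each of the finitely
  many sign patterns of the first \<open>n\<close> functions is realized on a nonempty relatively open subset of
  \<open>P\<close>.  Every such subset contains a point where \<open>h\<close> is low and one where \<open>h\<close> is high, and one index
  \<open>i\<close> approximates \<open>h\<close> at all these points simultaneously; so \<open>F i\<close> splits every pattern.
\<close>

lemma oscillation_imp_independent_sequence:
  fixes F :: "'i \<Rightarrow> 'a \<Rightarrow> real"
  assumes cont: "\<And>i. i \<in> I \<Longrightarrow> continuous_map X euclideanreal (F i)"
    and approx: "\<And>S e. finite S \<Longrightarrow> S \<subseteq> topspace X \<Longrightarrow> 0 < e \<Longrightarrow> \<exists>i\<in>I. \<forall>x\<in>S. \<bar>F i x - h x\<bar> < e"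
    and P: "P \<noteq> {}" and ab: "a < b"
    and low: "P \<subseteq> X closure_of {x \<in> P. h x \<le> a}" and high: "P \<subseteq> X closure_of {x \<in> P. b \<le> h x}"
  obtains g :: "nat \<Rightarrow> 'i" and c d where "c < d" "\<And>k. g k \<in> I"
    "\<And>n A. \<exists>x\<in>topspace X. \<forall>k<n. if k \<in> A then F (g k) x \<le> c else d \<le> F (g k) x"
proof -
  define e where "e = (b - a) / 3"
  define V where "V g n A = {x \<in> P. \<forall>k<n. if k \<in> A then F (g k) x < a + e else b - e < F (g k) x}"
    for g :: "nat \<Rightarrow> 'i" and n :: nat and A
  have e: "0 < e" "a + e < b - e" using ab by (auto simp: e_def field_simps)
  have PX: "P \<subseteq> topspace X" using low closure_of_subset_topspace by fast
  \<comment> \<open>The condition on the \<open>n\<close>-th choice \<open>i\<close>, given the earlier choices \<open>g 0, \<dots>, g (n - 1)\<close>.\<close>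
  define R where "R g n i \<longleftrightarrow> i \<in> I \<and> (\<forall>A. V (g(n := i)) (Suc n) A \<noteq> {})" for g n i
  have V_cong: "V f n A = V g n A" if "\<And>k. k < n \<Longrightarrow> f k = g k" for f g n A
    using that by (simp add: V_def)
  have step: "\<exists>i. R g n i" if g: "\<And>m. m < n \<Longrightarrow> R g m (g m)" for g n
  proof -
    have gI: "g k \<in> I" if "k < n" for k using g that by (auto simp: R_def)
    have ne: "V g n A \<noteq> {}" for A
    proof (cases n)
      case 0
      then show ?thesis using P by (auto simp: V_def)
    next
      case (Suc m)
      have "R g m (g m)" using g Suc by blast
      then show ?thesis unfolding R_def Suc by simp
    qed
    have "openin X {x \<in> topspace X. \<forall>k<m. if k \<in> A then F (g k) x < a + e else b - e < F (g k) x}"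
      if "m \<le> n" for A m
      using that
    proof (induction m)
      case (Suc m)
      have "openin X {x \<in> topspace X. F (g m) x \<in> (if m \<in> A then {..<a + e} else {b - e<..})}"
        by (rule openin_continuous_map_preimage[OF cont]) (use gI Suc.prems in auto)
      moreover have "openin X {x \<in> topspace X. \<forall>k<m. if k \<in> A then F (g k) x < a + e else b - e < F (g k) x}"
        using Suc by simp
      ultimately have "openin X ({x \<in> topspace X. \<forall>k<m. if k \<in> A then F (g k) x < a + e else b - e < F (g k) x}
         \<inter> {x \<in> topspace X. F (g m) x \<in> (if m \<in> A then {..<a + e} else {b - e<..})})"
        by (intro openin_Int)
      moreover have "\<dots> = {x \<in> topspace X. \<forall>k<Suc m. if k \<in> A then F (g k) x < a + e else b - e < F (g k) x}"
        by (auto simp: less_Suc_eq)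
      ultimately show ?case by simp
    qed simp
    then have op: "openin X {x \<in> topspace X. \<forall>k<n. if k \<in> A then F (g k) x < a + e else b - e < F (g k) x}" (is "openin X (?O A)") for A
      by simp
    have hit: "\<exists>x\<in>V g n A. Q x" if cl: "P \<subseteq> X closure_of {x \<in> P. Q x}" for Q A
    proof -
      obtain p where "p \<in> V g n A" using ne by blast
      then have "p \<in> X closure_of {x \<in> P. Q x}" "p \<in> ?O A"
        using cl PX by (auto simp: V_def)
      with op[of A] have "\<exists>y. y \<in> {x \<in> P. Q x} \<and> y \<in> ?O A"
        by (meson in_closure_of)
      then show ?thesis by (auto simp: V_def)
    qed
    obtain xl where xl: "\<And>A. xl A \<in> V g n A" "\<And>A. h (xl A) \<le> a"
      using hit[OF low] by metis
    obtain xh where xh: "\<And>A. xh A \<in> V g n A" "\<And>A. b \<le> h (xh A)"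
      using hit[OF high] by metis
    have "xl ` Pow {..<n} \<union> xh ` Pow {..<n} \<subseteq> topspace X"
      using xl(1) xh(1) PX by (auto simp: V_def)
    then obtain i where i: "i \<in> I" "\<And>x. x \<in> xl ` Pow {..<n} \<union> xh ` Pow {..<n} \<Longrightarrow> \<bar>F i x - h x\<bar> < e"
      using approx[of "xl ` Pow {..<n} \<union> xh ` Pow {..<n}" e] e by auto
    have "V (g(n := i)) (Suc n) A \<noteq> {}" for A
    proof -
      \<comment> \<open>Only the trace of the pattern on the earlier indices matters, so the finitely many points
        chosen above suffice.\<close>
      define A' where "A' = A \<inter> {..<n}"
      have "A' \<in> Pow {..<n}" by (auto simp: A'_def)
      then have *: "\<bar>F i (xl A') - h (xl A')\<bar> < e" "\<bar>F i (xh A') - h (xh A')\<bar> < e"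
        using i(2) by blast+
      show ?thesis
      proof (cases "n \<in> A")
        case True
        have "F i (xl A') < a + e" using * xl(2)[of A'] by linarith
        then have "xl A' \<in> V (g(n := i)) (Suc n) A"
          using xl(1)[of A'] True by (auto simp: V_def A'_def less_Suc_eq split: if_splits)
        then show ?thesis by blast
      next
        case False
        have "b - e < F i (xh A')" using * xh(2)[of A'] by linarith
        then have "xh A' \<in> V (g(n := i)) (Suc n) A"
          using xh(1)[of A'] False by (auto simp: V_def A'_def less_Suc_eq split: if_splits)
        then show ?thesis by blast
      qed
    qed
    then show ?thesis using i(1) by (auto simp: R_def)
  qed
  have "\<exists>g. \<forall>n. R g n (g n)"
  proof (rule dependent_wellorder_choice)
    fix r n and f g :: "nat \<Rightarrow> 'i" assume "\<And>m. m < n \<Longrightarrow> f m = g m"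
    then have "V (f(n := r)) (Suc n) A = V (g(n := r)) (Suc n) A" for A
      by (intro V_cong) (auto simp: less_Suc_eq)
    then show "R f n r = R g n r" by (simp add: R_def)
  qed (rule step)
  then obtain g where g: "\<And>n. R g n (g n)" by blast
  have "\<exists>x\<in>topspace X. \<forall>k<n. if k \<in> A then F (g k) x \<le> a + e else b - e \<le> F (g k) x" for n A
  proof -
    have "V g (Suc n) A \<noteq> {}" using g[of n] by (simp add: R_def)
    then obtain x where x: "x \<in> P" "\<And>k. k < Suc n \<Longrightarrow> if k \<in> A then F (g k) x < a + e else b - e < F (g k) x"
      by (auto simp: V_def)
    have "if k \<in> A then F (g k) x \<le> a + e else b - e \<le> F (g k) x" if "k < n" for k
      using x(2)[of k] that by (auto split: if_splits)
    then show ?thesis using x(1) PX by blast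
  qed
  then show thesis using that[of "a + e" "b - e" g] e g by (auto simp: R_def)
qed

lemma independent_sequence_compact:
  fixes F :: "nat \<Rightarrow> 'a \<Rightarrow> real"
  assumes X: "compact_space X" and cont: "\<And>k. continuous_map X euclideanreal (F k)"
    and fin: "\<And>n. \<exists>x\<in>topspace X. \<forall>k<n. if k \<in> A then F k x \<le> c else d \<le> F k x"
  shows "\<exists>x\<in>topspace X. \<forall>k. if k \<in> A then F k x \<le> c else d \<le> F k x"
proof -
  define C where "C n = {x \<in> topspace X. \<forall>k<n. if k \<in> A then F k x \<le> c else d \<le> F k x}" for n
  have clo: "closedin X (C n)" for n
  proof (induction n)
    case (Suc n)
    have "closedin X {x \<in> topspace X. F n x \<in> (if n \<in> A then {..c} else {d..})}"
      by (rule closedin_continuous_map_preimage[OF cont]) auto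
    then have "closedin X (C n \<inter> {x \<in> topspace X. F n x \<in> (if n \<in> A then {..c} else {d..})})"
      using Suc by (intro closedin_Int)
    moreover have "\<dots> = C (Suc n)" by (auto simp: C_def less_Suc_eq)
    ultimately show ?case by simp
  qed (simp add: C_def)
  have "(\<Inter>n. C n) \<noteq> {}"
  proof (rule compact_space_imp_nest[OF X clo])
    show "C n \<noteq> {}" for n using fin[of n] by (auto simp: C_def)
    show "decseq C" by (auto simp: decseq_def C_def)
  qed
  then obtain x where x: "\<And>n. x \<in> C n" by blast
  have "if k \<in> A then F k x \<le> c else d \<le> F k x" for k using x[of "Suc k"] by (simp add: C_def)
  moreover have "x \<in> topspace X" using x[of 0] by (simp add: C_def)
  ultimately show ?thesis by blast
qed

section \<open>Copies of the Stone-Cech compactification of the integers\<close>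

text \<open>
  In a compact Hausdorff space this characterizes the sequences whose closure is a copy of
  \<open>beta_nat\<close> with the integers in their usual place.
\<close>

definition complement_separated :: "'a topology \<Rightarrow> (nat \<Rightarrow> 'a) \<Rightarrow> bool" where
  "complement_separated K x \<longleftrightarrow> range x \<subseteq> topspace K \<and>
     (\<forall>A. disjnt (K closure_of (x ` A)) (K closure_of (x ` (- A))))"

text \<open>
  In the application \<open>Z\<close> is the closure of the graph that matches two sequences and \<open>p\<close>, \<open>q\<close> are its
  two projections.  If \<open>p\<close> identified points \<open>u\<close> and \<open>v\<close>, then \<open>q u\<close> and \<open>q v\<close> would have disjoint
  neighbourhoods; let \<open>A\<close> be the set of indices that \<open>q\<close> sends into the first one.  Then \<open>u\<close> is a
  limit of the points indexed by \<open>A\<close> and \<open>v\<close> of those indexed by its complement, so \<open>p u = p v\<close>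
  lies in two closures that the separation hypothesis keeps apart.
\<close>

lemma homeomorphic_map_onto_closure:
  assumes Z: "compact_space Z" and z: "range z \<subseteq> topspace Z" "Z closure_of range z = topspace Z"
    and p: "continuous_map Z S p" and q: "continuous_map Z K q"
    and S: "Hausdorff_space S" and K: "Hausdorff_space K"
    and joint: "\<And>u v. u \<in> topspace Z \<Longrightarrow> v \<in> topspace Z \<Longrightarrow> p u = p v \<Longrightarrow> q u = q v \<Longrightarrow> u = v"
    and sep: "complement_separated S (\<lambda>n. p (z n))"
  shows "homeomorphic_map Z (subtopology S (S closure_of range (\<lambda>n. p (z n)))) p"
proof (rule continuous_imp_homeomorphic_map)
  let ?C = "S closure_of range (\<lambda>n. p (z n))"
  have rng: "range (\<lambda>n. p (z n)) = p ` range z" by auto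
  have "p ` topspace Z \<subseteq> ?C"
    using continuous_map_image_closure_subset[OF p, of "range z"] z(2) by (simp add: rng)
  moreover have "closedin S (p ` topspace Z)"
    using image_compactin[OF _ p] Z S by (simp add: compact_space_def compactin_imp_closedin)
  then have "?C \<subseteq> p ` topspace Z"
    using z(1) by (intro closure_of_minimal) (auto simp: rng)
  ultimately have img: "p ` topspace Z = ?C" by blast
  then show "continuous_map Z (subtopology S ?C) p"
    using p by (auto simp: continuous_map_in_subtopology)
  show "p ` topspace Z = topspace (subtopology S ?C)"
    using img closure_of_subset_topspace[of S] by (simp add: inf.absorb2)
  show "Hausdorff_space (subtopology S ?C)" by (rule Hausdorff_space_subtopology[OF S])
  show "inj_on p (topspace Z)"
  proof (rule inj_onI, rule ccontr)
    fix u v assume uv: "u \<in> topspace Z" "v \<in> topspace Z" "p u = p v" "u \<noteq> v"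
    then have "q u \<noteq> q v" using joint by blast
    moreover have "q u \<in> topspace K" "q v \<in> topspace K" using uv q by (auto simp: continuous_map_def)
    ultimately obtain U V where UV: "openin K U" "openin K V" "q u \<in> U" "q v \<in> V" "disjnt U V"
      using K unfolding Hausdorff_space_def by metis
    have near: "w \<in> Z closure_of (z ` {n. q (z n) \<in> W})" if w: "w \<in> topspace Z" "openin K W" "q w \<in> W" for w W
      unfolding in_closure_of
    proof (intro conjI allI impI)
      fix O' assume O': "w \<in> O' \<and> openin Z O'"
      have "openin Z {y \<in> topspace Z. q y \<in> W}" by (rule openin_continuous_map_preimage[OF q w(2)])
      then have op: "openin Z (O' \<inter> {y \<in> topspace Z. q y \<in> W})" using O' by blast
      have "w \<in> Z closure_of range z" using z(2) w by simp
      moreover have "w \<in> O' \<inter> {y \<in> topspace Z. q y \<in> W}" using O' w by blast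
      ultimately have "\<exists>y. y \<in> range z \<and> y \<in> O' \<inter> {y \<in> topspace Z. q y \<in> W}"
        using op by (meson in_closure_of)
      then show "\<exists>y. y \<in> z ` {n. q (z n) \<in> W} \<and> y \<in> O'" by blast
    qed (fact w(1))
    define A where "A = {n. q (z n) \<in> U}"
    have "u \<in> Z closure_of (z ` A)" unfolding A_def using near uv UV by blast
    moreover have "v \<in> Z closure_of (z ` (- A))"
    proof -
      have "{n. q (z n) \<in> V} \<subseteq> - A" using UV(5) by (auto simp: A_def disjnt_def)
      then show ?thesis using near[of v V] uv UV closure_of_mono[of "z ` {n. q (z n) \<in> V}" "z ` (- A)" Z] by blast
    qed
    ultimately have "p u \<in> S closure_of (p ` z ` A)" "p v \<in> S closure_of (p ` z ` (- A))"
      using continuous_map_image_closure_subset[OF p] by blast+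
    moreover have "disjnt (S closure_of (p ` z ` A)) (S closure_of (p ` z ` (- A)))"
      using sep unfolding complement_separated_def image_image by blast
    ultimately show False using uv(3) by (auto simp: disjnt_def)
  qed
qed (rule Z)

text \<open>
  The hypotheses are symmetric in the two sequences, so both projections of the closed graph are
  homeomorphisms onto the respective closures.
\<close>

lemma complement_separated_closures_homeomorphic:
  assumes S: "compact_space S" "Hausdorff_space S" and K: "compact_space K" "Hausdorff_space K"
    and s: "complement_separated S s" and x: "complement_separated K x"
  shows "subtopology S (S closure_of range s) homeomorphic_space subtopology K (K closure_of range x)"
proof -
  let ?SK = "prod_topology S K"
  define z where "z n = (s n, x n)" for n
  define Z where "Z = subtopology ?SK (?SK closure_of range z)"
  have z: "range z \<subseteq> topspace ?SK"
    using s x by (auto simp: complement_separated_def z_def)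
  have tZ: "topspace Z = ?SK closure_of range z"
    using closure_of_subset_topspace[of ?SK] by (simp add: Z_def inf.absorb2)
  have zZ: "range z \<subseteq> topspace Z" using closure_of_subset[OF z] by (simp add: tZ)
  have dense: "Z closure_of range z = topspace Z"
    using zZ unfolding tZ by (simp add: Z_def closure_of_subtopology inf.absorb2)
  have "compact_space ?SK" using S K by (simp add: compact_space_prod_topology)
  then have Z: "compact_space Z"
    unfolding Z_def by (intro compact_space_subtopology closedin_compact_space) auto
  have p: "continuous_map Z S fst" and q: "continuous_map Z K snd"
    unfolding Z_def by (intro continuous_map_from_subtopology continuous_map_fst continuous_map_snd)+
  have s_eq: "s = (\<lambda>n. fst (z n))" and x_eq: "x = (\<lambda>n. snd (z n))" by (simp_all add: z_def)
  have "homeomorphic_map Z (subtopology S (S closure_of range (\<lambda>n. fst (z n)))) fst"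
    by (rule homeomorphic_map_onto_closure[OF Z zZ dense p q]) (use S K s in \<open>auto simp: z_def prod_eq_iff\<close>)
  then have SZ: "subtopology S (S closure_of range s) homeomorphic_space Z"
    unfolding s_eq using homeomorphic_map_imp_homeomorphic_space homeomorphic_space_sym by blast
  have "homeomorphic_map Z (subtopology K (K closure_of range (\<lambda>n. snd (z n)))) snd"
    by (rule homeomorphic_map_onto_closure[OF Z zZ dense q p]) (use S K x in \<open>auto simp: z_def prod_eq_iff\<close>)
  then have "Z homeomorphic_space subtopology K (K closure_of range x)"
    unfolding x_eq by (rule homeomorphic_map_imp_homeomorphic_space)
  with SZ show ?thesis by (rule homeomorphic_space_trans)
qed

abbreviation nat_cube :: "((nat \<Rightarrow> real) \<Rightarrow> real) topology" where
  "nat_cube \<equiv> product_topology (\<lambda>_. top_of_set {0..1})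
     (unit_interval_maps (discrete_topology (UNIV :: nat set)))"

definition nat_eval :: "nat \<Rightarrow> (nat \<Rightarrow> real) \<Rightarrow> real" where
  "nat_eval n = (\<lambda>f \<in> unit_interval_maps (discrete_topology (UNIV :: nat set)). f n)"

lemma beta_nat_eq: "beta_nat = subtopology nat_cube (nat_cube closure_of range nat_eval)"
  by (simp add: stone_cech_def Let_def nat_eval_def)

lemma unit_interval_maps_nat:
  "unit_interval_maps (discrete_topology (UNIV :: nat set)) = {f. range f \<subseteq> {0..1}}"
  by (auto simp: unit_interval_maps_def image_subset_iff Pi_iff)

lemma compact_space_nat_cube: "compact_space nat_cube"
  by (simp add: compact_space_product_topology compact_space_subtopology compactin_euclidean_iff)

lemma Hausdorff_space_nat_cube: "Hausdorff_space nat_cube"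
  by (simp add: Hausdorff_space_product_topology Hausdorff_space_subtopology)

lemma range_nat_eval: "range nat_eval \<subseteq> topspace nat_cube"
  by (auto simp: nat_eval_def unit_interval_maps_nat image_subset_iff)

lemma closedin_nat_cube_coordinate:
  assumes "f \<in> unit_interval_maps (discrete_topology (UNIV :: nat set))"
  shows "closedin nat_cube {p \<in> topspace nat_cube. p f = t}"
proof -
  have "continuous_map nat_cube euclideanreal (\<lambda>p. p f)"
    using continuous_map_product_projection[OF assms, of "\<lambda>_. top_of_set {0..1::real}"]
    by (simp add: continuous_map_in_subtopology)
  then have "closedin nat_cube {p \<in> topspace nat_cube. p f \<in> {t}}"
    by (rule closedin_continuous_map_preimage) auto
  then show ?thesis by simp
qed

lemma complement_separated_nat_eval: "complement_separated nat_cube nat_eval"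
  unfolding complement_separated_def
proof (intro conjI allI)
  show "range nat_eval \<subseteq> topspace nat_cube" by (rule range_nat_eval)
  fix A :: "nat set"
  let ?f = "indicator A :: nat \<Rightarrow> real"
  have f: "?f \<in> unit_interval_maps (discrete_topology UNIV)"
    by (auto simp: unit_interval_maps_nat indicator_def)
  have "nat_cube closure_of (nat_eval ` B) \<subseteq> {p \<in> topspace nat_cube. p ?f = t}"
    if "\<And>n. n \<in> B \<Longrightarrow> indicator A n = t" for B t
    by (rule closure_of_minimal[OF _ closedin_nat_cube_coordinate[OF f]])
       (use range_nat_eval f that in \<open>auto simp: nat_eval_def\<close>)
  from this[of A 1] this[of "- A" 0]
  show "disjnt (nat_cube closure_of (nat_eval ` A)) (nat_cube closure_of (nat_eval ` (- A)))"
    by (force simp: disjnt_def)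
qed

theorem complement_separated_imp_beta_nat_embeds:
  assumes K: "compact_space K" "Hausdorff_space K" and x: "complement_separated K x"
  shows "\<exists>e. embedding_map beta_nat K e"
proof -
  have "beta_nat homeomorphic_space subtopology K (K closure_of range x)"
    unfolding beta_nat_eq
    by (rule complement_separated_closures_homeomorphic[OF compact_space_nat_cube
          Hausdorff_space_nat_cube K complement_separated_nat_eval x])
  then obtain e where e: "homeomorphic_map beta_nat (subtopology K (K closure_of range x)) e"
    by (auto simp: homeomorphic_space)
  then have "e ` topspace beta_nat = topspace (subtopology K (K closure_of range x))"
    by (rule homeomorphic_imp_surjective_map)
  then have "e ` topspace beta_nat = K closure_of range x"
    using closure_of_subset_topspace[of K] by (simp add: inf.absorb2)
  with e show ?thesis unfolding embedding_map_def by metis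
qed

text \<open>
  Hausdorff's independent family of continuum many sets.  The integers code pairs of a bound \<open>m\<close>
  and a finite list of finite sets (themselves lists), and \<open>J A\<close> consists of the codes whose list
  contains the trace of \<open>A\<close> below \<open>m\<close>.  Finitely many sets have distinct traces below a large
  enough \<open>m\<close>, hence any prescribed membership pattern is realized.
\<close>

lemma independent_family_nat:
  obtains J :: "nat set \<Rightarrow> nat set"
  where "\<And>\<F> \<S>. finite \<F> \<Longrightarrow> \<exists>n. \<forall>A\<in>\<F>. n \<in> J A \<longleftrightarrow> A \<in> \<S>"
proof -
  define dec :: "nat \<Rightarrow> nat \<times> nat list list" where "dec = from_nat"
  define J where "J A = {n. A \<inter> {..<fst (dec n)} \<in> set ` set (snd (dec n))}" for A
  have "\<exists>n. \<forall>A\<in>\<F>. n \<in> J A \<longleftrightarrow> A \<in> \<S>" if fin: "finite \<F>" for \<F> \<S>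
  proof -
    have "\<exists>k. k \<in> A \<longleftrightarrow> k \<notin> B" if "A \<noteq> B" for A B :: "nat set" using that by blast
    then obtain w where w: "\<And>A B :: nat set. A \<noteq> B \<Longrightarrow> w A B \<in> A \<longleftrightarrow> w A B \<notin> B" by metis
    have "finite ((\<lambda>(A, B). w A B) ` (\<F> \<times> \<F>))" using fin by blast
    then obtain m where m: "(\<lambda>(A, B). w A B) ` (\<F> \<times> \<F>) \<subseteq> {..<m}"
      by (metis finite_nat_iff_bounded)
    have inj: "A = B" if "A \<in> \<F>" "B \<in> \<F>" "A \<inter> {..<m} = B \<inter> {..<m}" for A B
      using w[of A B] m that by (cases "A = B") auto
    obtain L where L: "set L = (\<lambda>A. sorted_list_of_set (A \<inter> {..<m})) ` (\<F> \<inter> \<S>)"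
      using finite_list[of "(\<lambda>A. sorted_list_of_set (A \<inter> {..<m})) ` (\<F> \<inter> \<S>)"] fin by blast
    have setL: "set ` set L = (\<lambda>A. A \<inter> {..<m}) ` (\<F> \<inter> \<S>)" by (simp add: L image_image)
    have "dec (to_nat (m, L)) = (m, L)" by (simp add: dec_def)
    then have "to_nat (m, L) \<in> J A \<longleftrightarrow> A \<in> \<S>" if "A \<in> \<F>" for A
      using inj[OF that] that by (auto simp: J_def setL)
    then show ?thesis by blast
  qed
  then show thesis using that by blast
qed

text \<open>
  By independence and compactness, for every family \<open>\<S>\<close> of sets of integers some point of
  \<open>beta_nat\<close> assigns the value one to the indicator function of \<open>J A\<close> exactly for \<open>A\<close> in \<open>\<S>\<close>.
\<close>

theorem lepoll_beta_nat: "(UNIV :: nat set set set) \<lesssim> topspace beta_nat"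
proof -
  obtain J :: "nat set \<Rightarrow> nat set"
    where J: "\<And>\<F> \<S>. finite \<F> \<Longrightarrow> \<exists>n. \<forall>A\<in>\<F>. n \<in> J A \<longleftrightarrow> A \<in> \<S>"
    using independent_family_nat by blast
  let ?f = "\<lambda>A. indicator (J A) :: nat \<Rightarrow> real"
  have f: "?f A \<in> unit_interval_maps (discrete_topology UNIV)" for A
    by (auto simp: unit_interval_maps_nat indicator_def)
  have tb: "topspace beta_nat = nat_cube closure_of range nat_eval"
    unfolding beta_nat_eq using closure_of_subset_topspace[of nat_cube] by (simp add: inf.absorb2)
  have comp: "compact_space beta_nat"
    unfolding beta_nat_eq
    by (intro compact_space_subtopology closedin_compact_space compact_space_nat_cube) auto
  have "\<exists>p\<in>topspace beta_nat. \<forall>A. p (?f A) = indicator \<S> A" for \<S>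
  proof -
    define C where "C A = {p \<in> topspace beta_nat. p (?f A) = indicator \<S> A}" for A
    have "closedin beta_nat (C A)" for A
    proof -
      have "C A = {p \<in> topspace nat_cube. p (?f A) = indicator \<S> A} \<inter> (nat_cube closure_of range nat_eval)"
        using closure_of_subset_topspace[of nat_cube] by (auto simp: C_def tb)
      then show ?thesis
        unfolding beta_nat_eq closedin_subtopology using closedin_nat_cube_coordinate[OF f] by blast
    qed
    moreover have "\<Inter>\<U> \<noteq> {}" if \<U>: "finite \<U>" "\<U> \<subseteq> range C" for \<U>
    proof -
      obtain \<F> where \<F>: "finite \<F>" "\<U> = C ` \<F>" using finite_subset_image[OF \<U>] by blast
      obtain n where n: "\<forall>A\<in>\<F>. n \<in> J A \<longleftrightarrow> A \<in> \<S>" using J[OF \<F>(1), of \<S>] by blast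
      have "nat_eval n \<in> topspace beta_nat"
        using closure_of_subset[OF range_nat_eval] by (auto simp: tb)
      then have "nat_eval n \<in> C A" if "A \<in> \<F>" for A
        using n that f[of A] by (auto simp: C_def nat_eval_def indicator_def)
      then show ?thesis using \<F>(2) by blast
    qed
    ultimately have "\<Inter>(range C) \<noteq> {}"
      using comp unfolding compact_space_fip by (metis (no_types, lifting) rangeE)
    then show ?thesis by (auto simp: C_def)
  qed
  then obtain p where p: "\<And>\<S>. p \<S> \<in> topspace beta_nat" "\<And>\<S> A. p \<S> (?f A) = indicator \<S> A" by metis
  have "inj p"
  proof (rule injI)
    fix \<S> \<T> assume "p \<S> = p \<T>"
    then have eq: "(indicator \<S> A :: real) = indicator \<T> A" for A using p(2) by metis
    have "A \<in> \<S> \<longleftrightarrow> A \<in> \<T>" for A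
      using eq[of A] by (auto simp: indicator_def of_bool_def split: if_splits)
    then show "\<S> = \<T>" by blast
  qed
  then show ?thesis using p(1) by (auto simp: lepoll_def)
qed

section \<open>Compact metrizable spaces and spaces of functions\<close>

lemma compact_metrizable_imp_completely_metrizable:
  assumes "compact_space X" "metrizable_space X"
  shows "completely_metrizable_space X"
  using assms Metric_space.compact_space_eq_mcomplete_mtotally_bounded
  unfolding metrizable_space_def completely_metrizable_space_def by metis

lemma compact_metrizable_imp_second_countable:
  assumes "compact_space X" "metrizable_space X"
  shows "second_countable X"
proof -
  obtain M d where M: "Metric_space M d" "X = Metric_space.mtopology M d"
    using assms(2) by (auto simp: metrizable_space_def)
  interpret Metric_space M d by fact
  have "mtotally_bounded M"
    using assms(1) M(2) compact_space_eq_mcomplete_mtotally_bounded by simp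
  then have "\<exists>K. finite K \<and> K \<subseteq> M \<and> M \<subseteq> (\<Union>x\<in>K. mball x (1 / Suc n))" for n
    unfolding mtotally_bounded_def by (meson of_nat_0_less_iff zero_less_Suc zero_less_divide_1_iff)
  then obtain K where K: "\<And>n. finite (K n)" "\<And>n. K n \<subseteq> M" "\<And>n. M \<subseteq> (\<Union>x\<in>K n. mball x (1 / Suc n))"
    by metis
  define \<B> where "\<B> = (\<Union>n. (\<lambda>x. mball x (1 / Suc n)) ` K n)"
  show ?thesis
    unfolding second_countable_def M(2)
  proof (intro exI[of _ \<B>] conjI allI impI ballI)
    show "countable \<B>" unfolding \<B>_def by (intro countable_UN countable_image) (auto intro: countable_finite K)
    show "openin mtopology V" if "V \<in> \<B>" for V using that by (auto simp: \<B>_def)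
    fix U x assume U: "openin mtopology U \<and> x \<in> U"
    then obtain r where r: "r > 0" "mball x r \<subseteq> U" and xM: "x \<in> M"
      unfolding openin_mtopology by blast
    obtain n where n: "1 / Suc n < r / 2" using r(1) nat_approx_posE half_gt_zero by blast
    obtain y where y: "y \<in> K n" "x \<in> mball y (1 / Suc n)" using K(3) xM by blast
    have "mball y (1 / Suc n) \<subseteq> mball x r"
    proof
      fix z assume z: "z \<in> mball y (1 / Suc n)"
      then have "d x z \<le> d x y + d y z" using y by (intro triangle) auto
      also have "\<dots> < r" using z y n commute[of x y] by auto
      finally show "z \<in> mball x r" using xM z by auto
    qed
    then show "\<exists>V\<in>\<B>. x \<in> V \<and> V \<subseteq> U" using y r unfolding \<B>_def by blast
  qed
qed

lemma compact_metrizable_imp_polish: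
  "compact_space X \<Longrightarrow> metrizable_space X \<Longrightarrow> polish_space_top X"
  by (simp add: polish_space_top_def compact_metrizable_imp_completely_metrizable
      compact_metrizable_imp_second_countable second_countable_imp_separable_space)

text \<open>
  The distances to the points of a countable dense set.
\<close>

lemma continuous_functions_separate_points:
  assumes "separable_space X" "metrizable_space X"
  obtains f :: "nat \<Rightarrow> 'a \<Rightarrow> real" where "\<And>n. continuous_map X euclideanreal (f n)"
    "\<And>x y. x \<in> topspace X \<Longrightarrow> y \<in> topspace X \<Longrightarrow> (\<And>n. f n x = f n y) \<Longrightarrow> x = y"
proof (cases "topspace X = {}")
  case True
  then show thesis using that[of "\<lambda>n x. 0"] by auto
next
  case False
  obtain M d where M: "Metric_space M d" "X = Metric_space.mtopology M d"
    using assms(2) by (auto simp: metrizable_space_def)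
  interpret Metric_space M d by fact
  obtain C where C: "countable C" "C \<subseteq> M" "mtopology closure_of C = M"
    using assms(1) M by (auto simp: separable_space_def)
  have "C \<noteq> {}" using C(3) False M by auto
  define f where "f n = d (from_nat_into C n)" for n
  have cM: "from_nat_into C n \<in> M" for n using from_nat_into[OF \<open>C \<noteq> {}\<close>] C(2) by blast
  have "continuous_map X euclideanreal (f n)" for n
    using continuous_map_mdist[of X "metric (M, d)" "\<lambda>x. from_nat_into C n" "\<lambda>x. x"] cM[of n]
      Metric_space_axioms
    unfolding f_def by (simp add: mdist_metric mtopology_of M)
  moreover have "x = y" if xy: "x \<in> topspace X" "y \<in> topspace X" "\<And>n. f n x = f n y" for x y
  proof (rule ccontr)
    assume "x \<noteq> y"
    have xM: "x \<in> M" "y \<in> M" using xy M by auto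
    then have pos: "0 < d x y / 2" using \<open>x \<noteq> y\<close> by simp
    obtain c where c: "c \<in> C" "c \<in> mball x (d x y / 2)"
      using C(3) xM(1) pos unfolding metric_closure_of by blast
    obtain n where n: "c = from_nat_into C n" using c(1) C(1) from_nat_into_surj by metis
    have "d c x = d c y" using xy(3)[of n] by (simp add: f_def n)
    moreover have "d x y \<le> d x c + d c y" using xM c by (intro triangle) auto
    ultimately show False using c(2) commute[of x c] by auto
  qed
  ultimately show thesis using that by blast
qed

text \<open>
  Spaces of continuous maps between second countable spaces are hereditarily separable for
  pointwise convergence: if a continuous \<open>f\<close> sends finitely many points into given open sets, then
  it sends basic neighbourhoods of them into basic open sets contained in these.  There are only
  countably many conditions of the latter kind, and one function satisfying each is enough.
\<close>

lemma countable_pointwise_dense_subset: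
  fixes F :: "('a \<Rightarrow> 'b) set"
  assumes X: "second_countable X" and Y: "second_countable Y"
    and F: "F \<subseteq> extensional (topspace X)" and cont: "\<And>f. f \<in> F \<Longrightarrow> continuous_map X Y f"
  obtains C where "countable C" "C \<subseteq> F"
    "F \<subseteq> product_topology (\<lambda>_. Y) (topspace X) closure_of C"
proof -
  obtain \<B> where \<B>: "countable \<B>" "\<And>V. V \<in> \<B> \<Longrightarrow> openin X V"
    "\<And>U x. openin X U \<Longrightarrow> x \<in> U \<Longrightarrow> \<exists>V\<in>\<B>. x \<in> V \<and> V \<subseteq> U"
    using X unfolding second_countable_def by metis
  obtain \<D> where \<D>: "countable \<D>" "\<And>V. V \<in> \<D> \<Longrightarrow> openin Y V"
    "\<And>U x. openin Y U \<Longrightarrow> x \<in> U \<Longrightarrow> \<exists>V\<in>\<D>. x \<in> V \<and> V \<subseteq> U"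
    using Y unfolding second_countable_def by metis
  define N where "N T = {f \<in> F. \<forall>(U, V)\<in>T. f ` U \<subseteq> V}" for T
  define \<T> where "\<T> = {T. finite T \<and> T \<subseteq> \<B> \<times> \<D> \<and> N T \<noteq> {}}"
  define C where "C = (\<lambda>T. SOME f. f \<in> N T) ` \<T>"
  have some: "(SOME f. f \<in> N T) \<in> N T" if "T \<in> \<T>" for T
    using that by (auto simp: \<T>_def some_in_eq)
  have "\<T> \<subseteq> {T. finite T \<and> T \<subseteq> \<B> \<times> \<D>}" by (auto simp: \<T>_def)
  moreover have "countable {T. finite T \<and> T \<subseteq> \<B> \<times> \<D>}"
    using \<B>(1) \<D>(1) by (intro countable_Collect_finite_subset) auto
  ultimately have "countable C" unfolding C_def using countable_subset by blast
  moreover have "C \<subseteq> F" using some by (auto simp: C_def N_def)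
  moreover have "f \<in> product_topology (\<lambda>_. Y) (topspace X) closure_of C" if f: "f \<in> F" for f
    unfolding in_closure_of
  proof (intro conjI allI impI)
    have inP: "g \<in> (\<Pi>\<^sub>E i\<in>topspace X. topspace Y)" if "g \<in> F" for g
      using F cont[OF that] that by (auto simp: PiE_def continuous_map_def)
    show "f \<in> topspace (product_topology (\<lambda>_. Y) (topspace X))" using inP[OF f] by simp
    fix W assume "f \<in> W \<and> openin (product_topology (\<lambda>_. Y) (topspace X)) W"
    then obtain U where U: "finite {i \<in> topspace X. U i \<noteq> topspace Y}" "\<And>i. i \<in> topspace X \<Longrightarrow> openin Y (U i)"
      "f \<in> Pi\<^sub>E (topspace X) U" "Pi\<^sub>E (topspace X) U \<subseteq> W"
      unfolding openin_product_topology_alt by metis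
    let ?J = "{i \<in> topspace X. U i \<noteq> topspace Y}"
    have "\<exists>A B. A \<in> \<B> \<and> B \<in> \<D> \<and> i \<in> A \<and> f ` A \<subseteq> B \<and> B \<subseteq> U i" if i: "i \<in> topspace X" for i
    proof -
      have "f i \<in> U i" using U(3) i by auto
      then obtain B where B: "B \<in> \<D>" "f i \<in> B" "B \<subseteq> U i" using \<D>(3) U(2)[OF i] by blast
      have "openin X {x \<in> topspace X. f x \<in> B}"
        using openin_continuous_map_preimage[OF cont[OF f] \<D>(2)[OF B(1)]] .
      then obtain A where "A \<in> \<B>" "i \<in> A" "A \<subseteq> {x \<in> topspace X. f x \<in> B}"
        using \<B>(3)[of "{x \<in> topspace X. f x \<in> B}" i] i B(2) by blast
      then show ?thesis using B by blast
    qed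
    then obtain A B where AB: "\<And>i. i \<in> topspace X \<Longrightarrow> A i \<in> \<B> \<and> B i \<in> \<D> \<and> i \<in> A i \<and> f ` A i \<subseteq> B i \<and> B i \<subseteq> U i"
      by metis
    define T where "T = (\<lambda>i. (A i, B i)) ` ?J"
    have "f \<in> N T" using AB f by (auto simp: N_def T_def)
    then have "T \<in> \<T>" using U(1) AB by (auto simp: \<T>_def T_def)
    define g where "g = (SOME g. g \<in> N T)"
    have gN: "g \<in> N T" unfolding g_def by (rule some[OF \<open>T \<in> \<T>\<close>])
    have "g \<in> Pi\<^sub>E (topspace X) U"
    proof (rule PiE_I)
      fix i assume i: "i \<in> topspace X"
      show "g i \<in> U i"
      proof (cases "U i = topspace Y")
        case True
        then show ?thesis using inP[of g] gN i by (auto simp: N_def)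
      next
        case False
        then have "g ` A i \<subseteq> B i" using gN i by (auto simp: N_def T_def)
        then show ?thesis using AB[OF i] by blast
      qed
    next
      fix i assume "i \<notin> topspace X"
      then show "g i = undefined" using gN F by (auto simp: N_def extensional_def)
    qed
    moreover have "g \<in> C" using \<open>T \<in> \<T>\<close> by (auto simp: C_def g_def)
    ultimately show "\<exists>g. g \<in> C \<and> g \<in> W" using U(4) by blast
  qed
  ultimately show thesis using that by blast
qed

text \<open>
  A continuous function is determined by its values on a countable dense set, and a function of
  the first class by a sequence of continuous ones, that is, by countably many reals.
\<close>

lemma first_baire_class_lepoll:
  assumes "separable_space Y"
  shows "first_baire_class Y \<lesssim> (UNIV :: nat set set)"
proof -
  obtain C where C: "countable C" "C \<subseteq> topspace Y" "Y closure_of C = topspace Y"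
    using assms by (auto simp: separable_space_def)
  obtain r :: "real \<Rightarrow> nat set" where r: "inj r"
    using eqpoll_sym[OF nat_sets_eqpoll_reals] by (auto simp: eqpoll_def bij_betw_def)
  define c where "c = from_nat_into C"
  define code :: "(nat \<Rightarrow> 'a \<Rightarrow> real) \<Rightarrow> nat set" where
    "code s = {prod_encode (n, prod_encode (k, i)) |n k i. i \<in> r (s n (c k))}" for s
  have "\<forall>f\<in>first_baire_class Y. \<exists>s :: nat \<Rightarrow> 'a \<Rightarrow> real. (\<forall>n. continuous_map Y euclideanreal (s n)) \<and>
          (\<forall>y \<in> topspace Y. (\<lambda>n. s n y) \<longlonglongrightarrow> f y)"
    by (auto simp: first_baire_class_def)
  then obtain s :: "('a \<Rightarrow> real) \<Rightarrow> nat \<Rightarrow> 'a \<Rightarrow> real" where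
    s: "\<And>f n. f \<in> first_baire_class Y \<Longrightarrow> continuous_map Y euclideanreal (s f n)"
       "\<And>f y. f \<in> first_baire_class Y \<Longrightarrow> y \<in> topspace Y \<Longrightarrow> (\<lambda>n. s f n y) \<longlonglongrightarrow> f y"
    by metis
  have "inj_on (\<lambda>f. code (s f)) (first_baire_class Y)"
  proof (rule inj_onI)
    fix f g assume fg: "f \<in> first_baire_class Y" "g \<in> first_baire_class Y" "code (s f) = code (s g)"
    have "r (s f n (c k)) = r (s g n (c k))" for n k
    proof -
      have "i \<in> r (s h n (c k)) \<longleftrightarrow> prod_encode (n, prod_encode (k, i)) \<in> code (s h)" for h i
        by (auto simp: code_def)
      then show ?thesis using fg(3) by auto
    qed
    then have "s f n (c k) = s g n (c k)" for n k using r by (simp add: inj_eq)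
    then have eq: "s f n y = s g n y" if "y \<in> C" for n y
      using that C(1) from_nat_into_surj unfolding c_def by metis
    have "s f n y = s g n y" if "y \<in> topspace Y" for n y
      by (rule forall_in_closure_of_eq[of y Y C euclideanreal]) (use that C s fg eq in auto)
    then have "f y = g y" if "y \<in> topspace Y" for y
      using s(2)[OF fg(1) that] s(2)[OF fg(2) that] that LIMSEQ_unique by simp
    then show "f = g"
      using fg(1,2) by (intro extensionalityI[of f "topspace Y"]) (auto simp: first_baire_class_def)
  qed
  then show ?thesis by (auto simp: lepoll_def)
qed

text \<open>
  The cardinality bound is what separates the two alternatives.
\<close>

lemma rosenthal_compact_lepoll:
  assumes "rosenthal_compact Z"
  shows "topspace Z \<lesssim> (UNIV :: nat set set)"
proof -
  obtain Y :: "real topology" and K where Y: "polish_space_top Y" and K: "K \<subseteq> first_baire_class Y"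
    "Z homeomorphic_space subtopology (product_topology (\<lambda>_. euclideanreal) (topspace Y)) K"
    using assms by (auto simp: rosenthal_compact_def rosenthal_compact_over_def)
  obtain h where "homeomorphic_map Z (subtopology (product_topology (\<lambda>_. euclideanreal) (topspace Y)) K) h"
    using K(2) by (auto simp: homeomorphic_space)
  then have "inj_on h (topspace Z)" "h ` topspace Z \<subseteq> K"
    using homeomorphic_imp_injective_map homeomorphic_imp_surjective_map by fastforce+
  then have "topspace Z \<lesssim> first_baire_class Y"
    using K(1) unfolding lepoll_def by blast
  also have "\<dots> \<lesssim> (UNIV :: nat set set)"
    using Y by (intro first_baire_class_lepoll) (simp add: polish_space_top_def)
  finally show ?thesis .
qed

lemma polish_space_lepoll:
  assumes "polish_space_top X"
  shows "topspace X \<lesssim> (UNIV :: nat set set)"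
proof -
  obtain Y :: "real topology" where "X homeomorphic_space Y"
    using polish_space_top_homeomorphic_real[OF assms] by metis
  then obtain h where "homeomorphic_map X Y h" by (auto simp: homeomorphic_space)
  then have "topspace X \<lesssim> (UNIV :: real set)"
    using homeomorphic_imp_injective_map unfolding lepoll_def by blast
  also have "\<dots> \<approx> (UNIV :: nat set set)" by (rule eqpoll_sym[OF nat_sets_eqpoll_reals])
  finally show ?thesis .
qed

lemma PiE_lepoll:
  assumes "A \<lesssim> (UNIV :: nat set set)"
  shows "(\<Pi>\<^sub>E x\<in>A. A) \<lesssim> (UNIV :: nat set set set)"
proof -
  obtain j :: "'a \<Rightarrow> nat set" where j: "inj_on j A" using assms by (auto simp: lepoll_def)
  define pair :: "nat set \<Rightarrow> nat set \<Rightarrow> nat set" where "pair S T = sum_encode ` (S <+> T)" for S T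
  have pair: "pair S T = pair S' T' \<Longrightarrow> S = S' \<and> T = T'" for S T S' T'
  proof -
    assume "pair S T = pair S' T'"
    then have eq: "S <+> T = S' <+> T'" by (simp add: pair_def inj_image_eq_iff[OF inj_sum_encode])
    have "S = {x. Inl x \<in> S <+> T}" "T = {x. Inr x \<in> S <+> T}"
      "S' = {x. Inl x \<in> S' <+> T'}" "T' = {x. Inr x \<in> S' <+> T'}" for S T S' T' :: "nat set" by auto
    then show "S = S' \<and> T = T'" using eq by metis
  qed
  define code where "code p = {pair (j x) (j (p x)) |x. x \<in> A}" for p
  have "inj_on code (\<Pi>\<^sub>E x\<in>A. A)"
  proof (rule inj_onI)
    fix p q assume pq: "p \<in> (\<Pi>\<^sub>E x\<in>A. A)" "q \<in> (\<Pi>\<^sub>E x\<in>A. A)" "code p = code q"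
    have "p x = q x" if x: "x \<in> A" for x
    proof -
      have "pair (j x) (j (p x)) \<in> code q" using pq(3) x by (auto simp: code_def)
      then obtain y where "y \<in> A" "pair (j x) (j (p x)) = pair (j y) (j (q y))" by (auto simp: code_def)
      then have "y \<in> A" "j x = j y" "j (p x) = j (q y)" using pair by blast+
      then show ?thesis using j x pq(1,2) by (metis PiE_mem inj_on_contraD)
    qed
    then show "p = q" using pq by (intro PiE_ext)
  qed
  then show ?thesis by (auto simp: lepoll_def)
qed

text \<open>
  Countably many functions of the first class on \<open>X\<close> are put together into a single one on the
  disjoint sum of countably many copies of \<open>X\<close>.
\<close>

lemma first_baire_class_disjoint_sum:
  assumes "\<And>n. (\<lambda>x\<in>topspace X. F n x) \<in> first_baire_class X"
  shows "(\<lambda>(x, n)\<in>topspace X \<times> UNIV. F n x)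
     \<in> first_baire_class (prod_topology X (discrete_topology (UNIV :: nat set)))"
proof -
  have "\<exists>s :: nat \<Rightarrow> 'a \<Rightarrow> real. (\<forall>m. continuous_map X euclideanreal (s m)) \<and>
          (\<forall>x \<in> topspace X. (\<lambda>m. s m x) \<longlonglongrightarrow> F n x)" for n
    using assms[of n] by (auto simp: first_baire_class_def)
  then obtain s :: "nat \<Rightarrow> nat \<Rightarrow> 'a \<Rightarrow> real" where
    s: "\<And>n m. continuous_map X euclideanreal (s n m)"
       "\<And>n x. x \<in> topspace X \<Longrightarrow> (\<lambda>m. s n m x) \<longlonglongrightarrow> F n x" by metis
  let ?XN = "prod_topology X (discrete_topology (UNIV :: nat set))"
  have "continuous_map ?XN euclideanreal (\<lambda>(x, n). s n m x)" for m
    unfolding continuous_map_def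
  proof (intro conjI allI impI)
    fix U :: "real set" assume U: "openin euclideanreal U"
    have "{z \<in> topspace ?XN. (case z of (x, n) \<Rightarrow> s n m x) \<in> U} = (\<Union>n. {x \<in> topspace X. s n m x \<in> U} \<times> {n})"
      by auto
    moreover have "openin ?XN ({x \<in> topspace X. s n m x \<in> U} \<times> {n})" for n
      using openin_continuous_map_preimage[OF s(1) U] by (simp add: openin_prod_Times_iff)
    ultimately show "openin ?XN {z \<in> topspace ?XN. (case z of (x, n) \<Rightarrow> s n m x) \<in> U}"
      by (metis (no_types, lifting) image_iff openin_Union)
  qed auto
  then show ?thesis
    using s(2) unfolding first_baire_class_def
    by (auto intro!: exI[of _ "\<lambda>m (x, n). s n m x"])
qed

lemma polish_space_top_prod_nat:
  assumes "polish_space_top X"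
  shows "polish_space_top (prod_topology X (discrete_topology (UNIV :: nat set)))"
proof -
  let ?N = "discrete_topology (UNIV :: nat set)"
  obtain C where C: "countable C" "C \<subseteq> topspace X" "X closure_of C = topspace X"
    using assms by (auto simp: polish_space_top_def separable_space_def)
  have "prod_topology X ?N closure_of (C \<times> UNIV) = topspace (prod_topology X ?N)"
    by (simp add: closure_of_Times C)
  moreover have "countable (C \<times> (UNIV :: nat set))" using C(1) by simp
  ultimately have "separable_space (prod_topology X ?N)"
    unfolding separable_space_def using C(2) by (intro exI[of _ "C \<times> UNIV"]) auto
  then show ?thesis
    using assms by (simp add: polish_space_top_def completely_metrizable_space_prod_topology
        completely_metrizable_space_discrete_topology)
qed

section \<open>The dichotomy for enveloping semigroups\<close>

context compact_metric_dynamical_system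
begin

abbreviation power_top :: "('x \<Rightarrow> 'x) topology" where
  "power_top \<equiv> product_topology (\<lambda>_. X) (topspace X)"

abbreviation E :: "('x \<Rightarrow> 'x) topology" where "E \<equiv> enveloping_topology G X \<phi>"

abbreviation orbit_top :: "('x \<Rightarrow> real) \<Rightarrow> ('x \<Rightarrow> real) topology" where
  "orbit_top f \<equiv> enveloping_orbit_topology G X \<phi> f"

lemma translation_in_power: "\<phi> ` carrier G \<subseteq> topspace power_top"
  using bij_prop0 by (force simp: BijGroup_def Bij_def PiE_def bij_betw_def)

lemma continuous_translation:
  assumes "g \<in> carrier G"
  shows "continuous_map X X (\<phi> g)"
proof -
  have "continuous_map X (prod_topology T X) (\<lambda>x. (g, x))"
    using assms by (simp add: continuous_map_pairwise o_def topspace_eq_carrier)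
  then have "continuous_map X X ((\<lambda>(g, x). \<phi> g x) \<circ> (\<lambda>x. (g, x)))"
    by (rule continuous_map_compose[OF _ continuous_action])
  then show ?thesis by (simp add: o_def)
qed

lemma topspace_E: "topspace E = enveloping_semigroup G X \<phi>"
  unfolding enveloping_topology_def enveloping_semigroup_def
  using closure_of_subset_topspace[of power_top] by (simp add: inf.absorb2)

lemma translation_in_E: "g \<in> carrier G \<Longrightarrow> \<phi> g \<in> topspace E"
  using closure_of_subset[OF translation_in_power] by (auto simp: topspace_E enveloping_semigroup_def)

lemma compact_space_E: "compact_space E"
  unfolding enveloping_topology_def enveloping_semigroup_def
  by (intro compact_space_subtopology closedin_compact_space)
     (simp_all add: compact_space_product_topology compact)

lemma Hausdorff_space_X: "Hausdorff_space X"
  by (rule metrizable_imp_Hausdorff_space[OF metrizable])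

lemma Hausdorff_space_E: "Hausdorff_space E"
  unfolding enveloping_topology_def
  by (intro Hausdorff_space_subtopology) (simp add: Hausdorff_space_product_topology Hausdorff_space_X)

lemma E_value: "p \<in> topspace E \<Longrightarrow> x \<in> topspace X \<Longrightarrow> p x \<in> topspace X"
  by (auto simp: enveloping_topology_def)

lemma continuous_evaluation:
  assumes "x \<in> topspace X" "continuous_map X euclideanreal f"
  shows "continuous_map E euclideanreal (\<lambda>p. f (p x))"
proof -
  have "continuous_map E X (\<lambda>p. p x)"
    unfolding enveloping_topology_def
    by (intro continuous_map_from_subtopology continuous_map_product_projection assms)
  then show ?thesis using continuous_map_compose assms(2) by (fastforce simp: o_def)
qed

lemma topspace_orbit_top:
  "topspace (orbit_top f) = (\<lambda>p. compose (topspace X) f p) ` topspace E"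
  by (auto simp: enveloping_orbit_topology_def topspace_E compose_def)

lemma continuous_compose_E:
  assumes "continuous_map X euclideanreal f"
  shows "continuous_map E (orbit_top f) (compose (topspace X) f)"
  unfolding enveloping_orbit_topology_def continuous_map_in_subtopology continuous_map_componentwise
  using continuous_evaluation[OF _ assms] by (auto simp: topspace_E compose_def)

lemma compact_space_orbit_top:
  assumes "continuous_map X euclideanreal f"
  shows "compact_space (orbit_top f)"
  using image_compactin[OF _ continuous_compose_E[OF assms], of "topspace E"] compact_space_E
  by (simp add: compact_space_def topspace_orbit_top)

lemma Hausdorff_space_orbit_top: "Hausdorff_space (orbit_top f)"
  unfolding enveloping_orbit_topology_def
  by (intro Hausdorff_space_subtopology) (simp add: Hausdorff_space_product_topology)

text \<open>
  The group is arbitrary, but its translations are continuous maps of a second countable space, so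
  countably many of them are dense among all of them.
\<close>

lemma separable_space_E: "separable_space E"
proof -
  have sc: "second_countable X" by (rule compact_metrizable_imp_second_countable[OF compact metrizable])
  obtain C where C: "countable C" "C \<subseteq> \<phi> ` carrier G" "\<phi> ` carrier G \<subseteq> power_top closure_of C"
  proof (rule countable_pointwise_dense_subset[OF sc sc])
    show "\<phi> ` carrier G \<subseteq> extensional (topspace X)"
      using translation_in_power by (auto simp: PiE_def)
  qed (use continuous_translation in auto)
  have CE: "C \<subseteq> topspace E" using C(2) translation_in_E by auto
  have "enveloping_semigroup G X \<phi> \<subseteq> power_top closure_of C"
    unfolding enveloping_semigroup_def by (rule closure_of_minimal[OF C(3)]) simp
  then have "E closure_of C = topspace E"
    using CE unfolding topspace_E
    by (simp add: enveloping_topology_def closure_of_subtopology inf.absorb2 inf.absorb1)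
  then show ?thesis unfolding separable_space_def using C(1) CE by blast
qed

lemma E_lepoll: "topspace E \<lesssim> (UNIV :: nat set set set)"
proof -
  have "topspace E \<lesssim> (\<Pi>\<^sub>E x\<in>topspace X. topspace X)"
    by (rule subset_imp_lepoll) (simp add: enveloping_topology_def)
  also have "\<dots> \<lesssim> (UNIV :: nat set set set)"
    by (rule PiE_lepoll[OF polish_space_lepoll[OF compact_metrizable_imp_polish[OF compact metrizable]]])
  finally show ?thesis .
qed

lemma approximation_by_translations:
  assumes f: "continuous_map X euclideanreal f" and p: "p \<in> topspace E"
    and S: "finite S" "S \<subseteq> topspace X" and e: "0 < e"
  shows "\<exists>g\<in>carrier G. \<forall>x\<in>S. \<bar>f (\<phi> g x) - f (p x)\<bar> < e"
proof -
  define W where "W = {q \<in> topspace power_top. \<forall>x\<in>S. f (q x) \<in> ball (f (p x)) e}"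
  have "openin power_top W"
    unfolding W_def using S
  proof (induction S rule: finite_induct)
    case (insert x S)
    have "continuous_map power_top X (\<lambda>q. q x)"
      using insert.prems by (intro continuous_map_product_projection) simp
    then have "continuous_map power_top euclideanreal (f \<circ> (\<lambda>q. q x))"
      by (rule continuous_map_compose[OF _ f])
    then have "continuous_map power_top euclideanreal (\<lambda>q. f (q x))" by (simp add: o_def)
    then have "openin power_top {q \<in> topspace power_top. f (q x) \<in> ball (f (p x)) e}"
      by (rule openin_continuous_map_preimage) simp
    with insert have "openin power_top ({q \<in> topspace power_top. f (q x) \<in> ball (f (p x)) e}
        \<inter> {q \<in> topspace power_top. \<forall>x\<in>S. f (q x) \<in> ball (f (p x)) e})"
      by (intro openin_Int) auto
    moreover have "\<dots> = {q \<in> topspace power_top. \<forall>x\<in>insert x S. f (q x) \<in> ball (f (p x)) e}" by blast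
    ultimately show ?case by simp
  qed (use openin_topspace[of power_top] in simp)
  moreover have "p \<in> W"
    using p e by (simp add: W_def enveloping_topology_def)
  moreover have "p \<in> power_top closure_of (\<phi> ` carrier G)"
    using p by (simp add: topspace_E enveloping_semigroup_def)
  ultimately have "\<exists>q. q \<in> \<phi> ` carrier G \<and> q \<in> W" by (meson in_closure_of)
  then obtain g where "g \<in> carrier G" "\<phi> g \<in> W" by blast
  then show ?thesis
    by (auto simp: W_def dist_real_def abs_minus_commute intro!: bexI[of _ g])
qed

text \<open>
  The dividing line of the dichotomy: every pointwise limit \<open>f \<circ> p\<close> of functions \<open>f \<circ> \<phi> g\<close> is of the
  first Baire class on the phase space itself.
\<close>

definition tame :: bool where
  "tame \<longleftrightarrow> (\<forall>f. continuous_map X euclideanreal f \<longrightarrow> topspace (orbit_top f) \<subseteq> first_baire_class X)"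

lemma polish_X: "polish_space_top X"
  by (rule compact_metrizable_imp_polish[OF compact metrizable])

lemma tame_imp_orbit_rosenthal:
  assumes tame and f: "continuous_map X euclideanreal f"
  shows "rosenthal_compact (orbit_top f)"
proof (rule rosenthal_compactI[OF polish_X])
  let ?P = "product_topology (\<lambda>_. euclideanreal) (topspace X)"
  have tb: "topspace (orbit_top f) \<subseteq> first_baire_class X" using assms by (simp add: tame_def)
  have sub: "topspace (orbit_top f) \<subseteq> topspace ?P"
    by (auto simp: topspace_orbit_top compose_def)
  have eq: "orbit_top f = subtopology ?P (topspace (orbit_top f))"
    unfolding topspace_orbit_top topspace_E by (simp add: enveloping_orbit_topology_def)
  have "compactin ?P (topspace (orbit_top f))"
    using sub eq compact_space_orbit_top[OF f] by (simp add: compactin_subspace)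
  then show "rosenthal_compact_over X (orbit_top f)"
    unfolding rosenthal_compact_over_def using tb eq homeomorphic_space_refl by metis
qed

text \<open>
  A sequence of continuous functions \<open>f n\<close> that separates the points of \<open>X\<close> embeds \<open>E\<close> into the
  product of the countably many spaces of functions \<open>f n \<circ> p\<close>, hence into the first Baire class of
  the disjoint sum of countably many copies of \<open>X\<close>.
\<close>

lemma tame_imp_E_rosenthal:
  assumes tame
  shows "rosenthal_compact E"
proof -
  let ?XN = "prod_topology X (discrete_topology (UNIV :: nat set))"
  let ?P = "product_topology (\<lambda>_. euclideanreal) (topspace ?XN)"
  obtain f :: "nat \<Rightarrow> 'x \<Rightarrow> real" where f: "\<And>n. continuous_map X euclideanreal (f n)"
    "\<And>x y. x \<in> topspace X \<Longrightarrow> y \<in> topspace X \<Longrightarrow> (\<And>n. f n x = f n y) \<Longrightarrow> x = y"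
    using continuous_functions_separate_points[of X] polish_X metrizable
    unfolding polish_space_top_def by metis
  define \<Phi> where "\<Phi> p = (\<lambda>(x, n)\<in>topspace X \<times> UNIV. f n (p x))" for p :: "'x \<Rightarrow> 'x"
  have cont: "continuous_map E ?P \<Phi>"
    unfolding continuous_map_componentwise
    using continuous_evaluation[OF _ f(1)] by (auto simp: \<Phi>_def)
  have inj: "inj_on \<Phi> (topspace E)"
  proof (rule inj_onI)
    fix p q assume pq: "p \<in> topspace E" "q \<in> topspace E" "\<Phi> p = \<Phi> q"
    have "p x = q x" if x: "x \<in> topspace X" for x
    proof (rule f(2))
      show "f n (p x) = f n (q x)" for n
        using fun_cong[OF pq(3), of "(x, n)"] x by (simp add: \<Phi>_def)
    qed (use E_value pq x in auto)
    moreover have "p \<in> extensional (topspace X)" "q \<in> extensional (topspace X)"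
      using pq by (auto simp: enveloping_topology_def PiE_def)
    ultimately show "p = q" by (intro extensionalityI) auto
  qed
  have "Hausdorff_space ?P" by (simp add: Hausdorff_space_product_topology)
  then have "embedding_map E ?P \<Phi>"
    by (rule continuous_imp_embedding_map[OF cont compact_space_E _ inj])
  then have "E homeomorphic_space subtopology ?P (\<Phi> ` topspace E)"
    by (rule embedding_map_imp_homeomorphic_space)
  moreover have "compactin ?P (\<Phi> ` topspace E)"
    using compact_space_E cont image_compactin unfolding compact_space_def by blast
  moreover have "\<Phi> ` topspace E \<subseteq> first_baire_class ?XN"
  proof (intro image_subsetI)
    fix p assume p: "p \<in> topspace E"
    have "(\<lambda>x\<in>topspace X. f n (p x)) \<in> first_baire_class X" for n
    proof -
      have "compose (topspace X) (f n) p \<in> first_baire_class X"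
        using assms f(1) p unfolding tame_def topspace_orbit_top by blast
      then show ?thesis by (simp add: compose_def)
    qed
    then show "\<Phi> p \<in> first_baire_class ?XN"
      unfolding \<Phi>_def by (rule first_baire_class_disjoint_sum)
  qed
  ultimately have "rosenthal_compact_over ?XN E"
    unfolding rosenthal_compact_over_def by blast
  then show ?thesis by (rule rosenthal_compactI[OF polish_space_top_prod_nat[OF polish_X]])
qed

text \<open>
  A function \<open>f \<circ> p\<close> outside the first class oscillates on a closed set and is approximated at
  finitely many points by functions \<open>f \<circ> \<phi> g\<close>; this yields translations along which \<open>f\<close> is
  independent.  Compactness of \<open>X\<close> realizes infinite sign patterns as well.
\<close>

lemma not_tame_imp_independent_translations:
  assumes "\<not> tame"
  obtains f g c d where "continuous_map X euclideanreal f" "c < d" "\<And>k::nat. g k \<in> carrier G"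
    "\<And>A. \<exists>x\<in>topspace X. \<forall>k. if k \<in> A then f (\<phi> (g k) x) \<le> c else d \<le> f (\<phi> (g k) x)"
proof -
  obtain f p where f: "continuous_map X euclideanreal f" and p: "p \<in> topspace E"
    and nb: "compose (topspace X) f p \<notin> first_baire_class X"
    using assms unfolding tame_def topspace_orbit_top by blast
  let ?h = "compose (topspace X) f p"
  have "compact (f ` topspace X)"
    using image_compactin[OF _ f, of "topspace X"] compact by (simp add: compact_space_def)
  then obtain M where M: "\<And>y. y \<in> topspace X \<Longrightarrow> \<bar>f y\<bar> \<le> M"
    using compact_imp_bounded bounded_iff by (metis imageI real_norm_def)
  have "\<exists>P a b. closedin X P \<and> P \<noteq> {} \<and> a < b \<and>
    P \<subseteq> X closure_of {x \<in> P. ?h x \<le> a} \<and> P \<subseteq> X closure_of {x \<in> P. b \<le> ?h x}"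
  proof (rule ccontr)
    assume neg: "\<nexists>P a b. closedin X P \<and> P \<noteq> {} \<and> a < b \<and>
      P \<subseteq> X closure_of {x \<in> P. ?h x \<le> a} \<and> P \<subseteq> X closure_of {x \<in> P. b \<le> ?h x}"
    have "?h \<in> first_baire_class X"
    proof (rule first_baire_class_criterion[OF metrizable
          compact_metrizable_imp_second_countable[OF compact metrizable]])
      show "\<bar>?h x\<bar> \<le> M" if "x \<in> topspace X" for x
        using M E_value[OF p that] that by (simp add: compose_def)
      show "\<not> (P \<subseteq> X closure_of {x \<in> P. ?h x \<le> a} \<and> P \<subseteq> X closure_of {x \<in> P. b \<le> ?h x})"
        if "closedin X P" "P \<noteq> {}" "a < b" for P a b
        using neg that by blast
    qed (rule compose_extensional)
    then show False using nb by contradiction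
  qed
  then obtain P a b where P: "P \<noteq> {}" and ab: "a < b" and low: "P \<subseteq> X closure_of {x \<in> P. ?h x \<le> a}"
    and high: "P \<subseteq> X closure_of {x \<in> P. b \<le> ?h x}" by blast
  have cont: "continuous_map X euclideanreal (\<lambda>x. f (\<phi> g x))" if "g \<in> carrier G" for g
    using continuous_map_compose[OF continuous_translation[OF that] f] by (simp add: o_def)
  have approx: "\<exists>g\<in>carrier G. \<forall>x\<in>S. \<bar>f (\<phi> g x) - ?h x\<bar> < e"
    if S: "finite S" "S \<subseteq> topspace X" "0 < e" for S e
  proof -
    have "?h x = f (p x)" if "x \<in> S" for x using S(2) that by (auto simp: compose_def)
    then show ?thesis using approximation_by_translations[OF f p S] by auto
  qed
  obtain g c d where cd: "c < d" "\<And>k::nat. g k \<in> carrier G"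
    "\<And>n A. \<exists>x\<in>topspace X. \<forall>k<n. if k \<in> A then f (\<phi> (g k) x) \<le> c else d \<le> f (\<phi> (g k) x)"
    by (rule oscillation_imp_independent_sequence[OF cont approx P ab low high]) blast+
  have "\<exists>x\<in>topspace X. \<forall>k. if k \<in> A then f (\<phi> (g k) x) \<le> c else d \<le> f (\<phi> (g k) x)" for A
    by (rule independent_sequence_compact[OF compact cont[OF cd(2)] cd(3)])
  with f cd show thesis using that by blast
qed

text \<open>
  For each set \<open>A\<close> of indices a single point \<open>x\<close> of the phase space witnesses the separation: the
  evaluation of \<open>f\<close> at \<open>x\<close> is at most \<open>c\<close> on the translations indexed by \<open>A\<close> and at least \<open>d\<close> on
  the others, and both inequalities persist in the closures.  The argument works simultaneously
  in \<open>E\<close> and in the orbit space of \<open>f\<close>.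
\<close>

lemma not_tame_imp_beta_nat_embeds:
  assumes "\<not> tame"
  shows "\<exists>e. embedding_map beta_nat E e"
    and "\<exists>f e. continuous_map X euclideanreal f \<and> embedding_map beta_nat (orbit_top f) e"
proof -
  obtain f g c d where f: "continuous_map X euclideanreal f" and cd: "c < d"
    and g: "\<And>k::nat. g k \<in> carrier G"
    and ind: "\<And>A. \<exists>x\<in>topspace X. \<forall>k. if k \<in> A then f (\<phi> (g k) x) \<le> c else d \<le> f (\<phi> (g k) x)"
    using not_tame_imp_independent_translations[OF assms] by metis
  have sep: "complement_separated K y"
    if y: "range y \<subseteq> topspace K"
      and ev: "\<And>x. x \<in> topspace X \<Longrightarrow> continuous_map K euclideanreal (ev x)"
      and eq: "\<And>k x. x \<in> topspace X \<Longrightarrow> ev x (y k) = f (\<phi> (g k) x)"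
    for K :: "'k topology" and y ev
    unfolding complement_separated_def
  proof (intro conjI allI y)
    fix A
    obtain x where x: "x \<in> topspace X"
      "\<And>k. if k \<in> A then f (\<phi> (g k) x) \<le> c else d \<le> f (\<phi> (g k) x)" using ind by blast
    have cl: "closedin K {q \<in> topspace K. ev x q \<in> {..c}}" "closedin K {q \<in> topspace K. ev x q \<in> {d..}}"
      by (rule closedin_continuous_map_preimage[OF ev[OF x(1)]]; simp)+
    have "K closure_of (y ` A) \<subseteq> {q \<in> topspace K. ev x q \<in> {..c}}"
      by (rule closure_of_minimal[OF _ cl(1)]) (use x y eq in \<open>auto split: if_splits\<close>)
    moreover have "K closure_of (y ` (- A)) \<subseteq> {q \<in> topspace K. ev x q \<in> {d..}}"
      by (rule closure_of_minimal[OF _ cl(2)]) (use x y eq in \<open>auto split: if_splits\<close>)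
    ultimately show "disjnt (K closure_of (y ` A)) (K closure_of (y ` (- A)))"
      using cd by (fastforce simp: disjnt_def)
  qed
  have "complement_separated E (\<lambda>k. \<phi> (g k))"
    by (rule sep[of _ _ "\<lambda>x p. f (p x)"]) (use g translation_in_E continuous_evaluation f in auto)
  then show "\<exists>e. embedding_map beta_nat E e"
    by (rule complement_separated_imp_beta_nat_embeds[OF compact_space_E Hausdorff_space_E])
  have "complement_separated (orbit_top f) (\<lambda>k. compose (topspace X) f (\<phi> (g k)))"
  proof (rule sep[of _ _ "\<lambda>x q. q x"])
    show "range (\<lambda>k. compose (topspace X) f (\<phi> (g k))) \<subseteq> topspace (orbit_top f)"
      using g translation_in_E by (auto simp: topspace_orbit_top)
    show "continuous_map (orbit_top f) euclideanreal (\<lambda>q. q x)" if "x \<in> topspace X" for x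
      unfolding enveloping_orbit_topology_def
      by (intro continuous_map_from_subtopology continuous_map_product_projection that)
  qed (simp add: compose_def)
  then have "\<exists>e. embedding_map beta_nat (orbit_top f) e"
    by (rule complement_separated_imp_beta_nat_embeds[OF compact_space_orbit_top[OF f] Hausdorff_space_orbit_top])
  with f show "\<exists>f e. continuous_map X euclideanreal f \<and> embedding_map beta_nat (orbit_top f) e" by blast
qed

end

lemma beta_nat_embeds_imp_lepoll:
  assumes "embedding_map beta_nat Z e"
  shows "(UNIV :: nat set set set) \<lesssim> topspace Z"
proof -
  have hom: "homeomorphic_map beta_nat (subtopology Z (e ` topspace beta_nat)) e"
    using assms by (simp add: embedding_map_def)
  have "inj_on e (topspace beta_nat)" by (rule homeomorphic_imp_injective_map[OF hom])
  moreover have "e ` topspace beta_nat \<subseteq> topspace Z"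
    using homeomorphic_imp_surjective_map[OF hom] unfolding topspace_subtopology by blast
  ultimately have "topspace beta_nat \<lesssim> topspace Z" unfolding lepoll_def by blast
  with lepoll_beta_nat show ?thesis by (rule lepoll_trans)
qed

lemma beta_nat_not_embeds_rosenthal_compact:
  assumes "rosenthal_compact Z"
  shows "\<not> embedding_map beta_nat Z e"
proof
  assume "embedding_map beta_nat Z e"
  then have "(UNIV :: nat set set set) \<lesssim> (UNIV :: nat set set)"
    using lepoll_trans beta_nat_embeds_imp_lepoll rosenthal_compact_lepoll[OF assms] by blast
  then have "\<exists>F. (UNIV :: nat set set set) \<subseteq> F ` (UNIV :: nat set set)" by (simp add: lepoll_iff)
  then obtain F :: "nat set \<Rightarrow> nat set set" where "UNIV \<subseteq> range F" by blast
  then show False using Cantors_theorem[of UNIV] by (metis Pow_UNIV top.extremum_uniqueI)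
qed

theorem theorem3p2:
  fixes G :: "('g, 'r) monoid_scheme" and T :: "'g topology"
    and X :: "'x topology" and \<phi> :: "'g \<Rightarrow> 'x \<Rightarrow> 'x"
  assumes "compact_metric_dynamical_system G T X \<phi>"
  shows "let E = enveloping_topology G X \<phi>;
             case1 = (separable_space E \<and> rosenthal_compact E);
             case2 = (\<exists>e. embedding_map beta_nat E e)
         in (case1 \<or> case2) \<and> \<not> (case1 \<and> case2) \<and>
            (case1 \<longrightarrow> topspace E \<lesssim> (UNIV :: nat set set)) \<and>
            (case2 \<longrightarrow> topspace E \<approx> (UNIV :: nat set set set)) \<and>
            (case1 \<longleftrightarrow>
              (\<forall>f. continuous_map X euclideanreal f \<longrightarrow>
                   rosenthal_compact (enveloping_orbit_topology G X \<phi> f)))"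
proof -
  interpret compact_metric_dynamical_system G T X \<phi> by (rule assms)
  define case1 where "case1 \<longleftrightarrow> separable_space E \<and> rosenthal_compact E"
  define case2 where "case2 \<longleftrightarrow> (\<exists>e. embedding_map beta_nat E e)"
  define orbits where "orbits \<longleftrightarrow>
    (\<forall>f. continuous_map X euclideanreal f \<longrightarrow> rosenthal_compact (orbit_top f))"
  \<comment> \<open>The case distinction is on tameness, and not on the first alternative: when tameness fails, the
    copy of \<open>beta_nat\<close> appears in \<open>E\<close> and in some orbit space, so it refutes both sides of the final
    equivalence by cardinality.\<close>
  have 1: "case1 \<and> orbits" if tame
    using that tame_imp_E_rosenthal tame_imp_orbit_rosenthal separable_space_E
    by (simp add: case1_def orbits_def)
  have 2: "case2 \<and> \<not> orbits" if nt: "\<not> tame"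
  proof
    show case2 unfolding case2_def by (rule not_tame_imp_beta_nat_embeds(1)[OF nt])
    obtain f e where f: "continuous_map X euclideanreal f" and e: "embedding_map beta_nat (orbit_top f) e"
      using not_tame_imp_beta_nat_embeds(2)[OF nt] by blast
    from e have "\<not> rosenthal_compact (orbit_top f)"
      using beta_nat_not_embeds_rosenthal_compact by (rule contrapos_pn)
    with f show "\<not> orbits" unfolding orbits_def by blast
  qed
  have 3: "\<not> (case1 \<and> case2)"
    unfolding case1_def case2_def by (auto dest: beta_nat_not_embeds_rosenthal_compact)
  have 4: "topspace E \<lesssim> (UNIV :: nat set set)" if case1
    using that unfolding case1_def by (intro rosenthal_compact_lepoll) simp
  have 5: "topspace E \<approx> (UNIV :: nat set set set)" if case2
  proof (rule lepoll_antisym[OF E_lepoll])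
    show "(UNIV :: nat set set set) \<lesssim> topspace E"
      using that unfolding case2_def by (auto dest: beta_nat_embeds_imp_lepoll)
  qed
  have "(case1 \<or> case2) \<and> \<not> (case1 \<and> case2) \<and> (case1 \<longrightarrow> topspace E \<lesssim> (UNIV :: nat set set)) \<and>
    (case2 \<longrightarrow> topspace E \<approx> (UNIV :: nat set set set)) \<and> (case1 \<longleftrightarrow> orbits)"
    using 1 2 3 4 5 by (cases tame) blast+
  then show ?thesis unfolding Let_def case1_def case2_def orbits_def .
qed

end
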